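(* Let $E$ be a Banach space of complex-valued functions on $\mathbb{R}^+$ satisfying (H1), (H2), (H3) (stated in the context), and let $S=S_1$ and $S_{-1}$ be the translation operators on $E$. Then $$\operatorname{spec}(S)\cap\bigl(\operatorname{spec}(S_{-1})\bigr)^{-1}=\Bigl\{z\in\mathbb{C}:\ \frac{1}{\rho(S_{-1})}\le|z|\le\rho(S)\Bigr\}.$$
   Context: $\mathbb{R}^+=[0,+\infty[$. $C_c^\infty(\mathbb{R}^+)$ is the space of $C^\infty$ functions on $\mathbb{R}$ with compact support contained in $]0,+\infty[$, regarded as functions on $\mathbb{R}^+$. Translations: for $a\ge 0$, $(S_af)(x)=f(x-a)$ for a.e. $x\ge a$ and $(S_af)(x)=0$ for $x\in[0,a[$; $(S_{-a}f)(x)=f(x+a)$ for a.e. $x\in\mathbb{R}^+$. Hypotheses on $E$: (H1) $C_c^\infty(\mathbb{R}^+)\subset E\subset L^1_{loc}(\mathbb{R}^+)$, the inclusions are continuous, and $C_c^\infty(\mathbb{R}^+)$ is dense in $E$. (H2) For every $x\in\mathbb{R}$, $S_xE\subset E$, and $\sup_{x\in K}\|S_x\|<+\infty$ for every compact $K\subset\mathbb{R}$. (H3) For every $a\in\mathbb{R}$ the operator $\Gamma_a$, $(\Gamma_af)(x)=e^{iax}f(x)$ a.e., is bounded on $E$, and $\sup_{a\in\mathbb{R}}\|\Gamma_a\|<+\infty$. $\operatorname{spec}(A)$ and $\rho(A)$ are the spectrum and spectral radius of a bounded operator $A$ on $E$. For $X\subset\mathbb{C}$, $X^{-1}=\{1/z: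 z\in X,\ z\ne0\}$. *)

theory Defs
  imports "HOL-Analysis.Analysis"
begin

section \<open>The space \<open>L\<^sup>1\<^sub>l\<^sub>o\<^sub>c\<close> of the half-line\<close>

definition loc_integrable :: "(real \<Rightarrow> complex) \<Rightarrow> bool" where
  "loc_integrable f \<longleftrightarrow> (\<forall>r. set_integrable lborel {0..r} f)"

definition ae_eq :: "(real \<Rightarrow> complex) \<Rightarrow> (real \<Rightarrow> complex) \<Rightarrow> bool" where
  "ae_eq f g \<longleftrightarrow> (AE x in lborel. 0 \<le> x \<longrightarrow> f x = g x)"

text \<open>Functions on \<open>[0,\<infinity>[\<close> are represented by functions on \<open>\<real>\<close> whose values at negative arguments
  are irrelevant.  Using Borel instead of Lebesgue measurable representatives gives the same
  space of classes.\<close>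

quotient_type l1loc = "real \<Rightarrow> complex" / partial:
  "\<lambda>f g. loc_integrable f \<and> loc_integrable g \<and> ae_eq f g"
  morphisms rep_l1loc class_of
proof (rule part_equivpI)
  show "\<exists>f. loc_integrable f \<and> loc_integrable f \<and> ae_eq f f"
    by (rule exI[of _ "\<lambda>_. 0"]) (simp add: loc_integrable_def ae_eq_def set_integrable_def)
  show "symp (\<lambda>f g. loc_integrable f \<and> loc_integrable g \<and> ae_eq f g)"
    by (rule sympI) (auto simp: ae_eq_def elim: eventually_mono)
  show "transp (\<lambda>f g. loc_integrable f \<and> loc_integrable g \<and> ae_eq f g)"
    by (rule transpI) (auto simp: ae_eq_def elim: eventually_elim2)
qed

instantiation l1loc :: ab_group_add
begin

lift_definition zero_l1loc :: l1loc is "\<lambda>_. 0"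
  by (simp add: loc_integrable_def ae_eq_def set_integrable_def)

lift_definition plus_l1loc :: "l1loc \<Rightarrow> l1loc \<Rightarrow> l1loc" is "\<lambda>f g x. f x + g x"
  by (auto simp: loc_integrable_def ae_eq_def intro!: set_integral_add elim: eventually_elim2)

lift_definition uminus_l1loc :: "l1loc \<Rightarrow> l1loc" is "\<lambda>f x. - f x"
  by (auto simp: loc_integrable_def ae_eq_def set_integrable_def elim: eventually_mono)

lift_definition minus_l1loc :: "l1loc \<Rightarrow> l1loc \<Rightarrow> l1loc" is "\<lambda>f g x. f x - g x"
  by (auto simp: loc_integrable_def ae_eq_def intro!: set_integral_diff elim: eventually_elim2)

instance
proof
  fix f g h :: l1loc
  show "f + g + h = f + (g + h)"
    by transfer (auto simp: loc_integrable_def ae_eq_def add.assoc intro!: set_integral_add)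
  show "f + g = g + f"
    by transfer (auto simp: loc_integrable_def ae_eq_def add.commute intro!: set_integral_add)
  show "0 + f = f"
    by transfer (auto simp: loc_integrable_def ae_eq_def)
  show "- f + f = 0"
    by transfer (auto simp: loc_integrable_def ae_eq_def set_integrable_def)
  show "f - g = f + - g"
    by transfer (auto simp: loc_integrable_def ae_eq_def intro!: set_integral_diff)
qed

end

lift_definition scale_l1loc :: "complex \<Rightarrow> l1loc \<Rightarrow> l1loc" is "\<lambda>c f x. c * f x"
  by (auto simp: loc_integrable_def ae_eq_def elim: eventually_mono)

interpretation l1loc: vector_space scale_l1loc
proof
  fix a b :: complex and f g :: l1loc
  show "scale_l1loc a (f + g) = scale_l1loc a f + scale_l1loc a g"
    by transfer (auto simp: loc_integrable_def ae_eq_def algebra_simps intro!: set_integral_add)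
  show "scale_l1loc (a + b) f = scale_l1loc a f + scale_l1loc b f"
    by transfer (auto simp: loc_integrable_def ae_eq_def algebra_simps intro!: set_integral_add)
  show "scale_l1loc a (scale_l1loc b f) = scale_l1loc (a * b) f"
    by transfer (auto simp: loc_integrable_def ae_eq_def algebra_simps)
  show "scale_l1loc 1 f = f"
    by transfer (auto simp: loc_integrable_def ae_eq_def)
qed

lift_definition l1_seminorm :: "real \<Rightarrow> l1loc \<Rightarrow> real" is
  "\<lambda>r f. (LINT x:{0..r}|lborel. cmod (f x))"
proof -
  fix r and f g :: "real \<Rightarrow> complex"
  assume *: "loc_integrable f \<and> loc_integrable g \<and> ae_eq f g"
  have m: "set_borel_measurable lborel {0..r} h"
    if "loc_integrable h" for h :: "real \<Rightarrow> complex"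
    using that borel_measurable_integrable
    unfolding loc_integrable_def set_borel_measurable_def set_integrable_def by blast
  have n: "(\<lambda>x. indicator {0..r} x *\<^sub>R cmod (h x)) \<in> borel_measurable lborel"
    if "loc_integrable h" for h :: "real \<Rightarrow> complex"
  proof -
    have "(\<lambda>x. indicator {0..r} x *\<^sub>R cmod (h x)) = (\<lambda>x. norm (indicator {0..r} x *\<^sub>R h x))"
      by (auto simp: fun_eq_iff indicator_def)
    moreover have "(\<lambda>x. norm (indicator {0..r} x *\<^sub>R h x)) \<in> borel_measurable lborel"
      using m[OF that] unfolding set_borel_measurable_def
      by (rule measurable_compose[OF _ borel_measurable_norm])
    ultimately show ?thesis by (simp only:)
  qed
  show "(LINT x:{0..r}|lborel. cmod (f x)) = (LINT x:{0..r}|lborel. cmod (g x))"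
    unfolding set_lebesgue_integral_def
  proof (rule integral_cong_AE)
    show "AE x in lborel. indicator {0..r} x *\<^sub>R cmod (f x) = indicator {0..r} x *\<^sub>R cmod (g x)"
      using * unfolding ae_eq_def by (auto simp: indicator_def elim!: eventually_mono)
  qed (use n * in auto)
qed

lemma l1_seminorm_mono: "r \<le> s \<Longrightarrow> l1_seminorm r f \<le> l1_seminorm s f"
proof transfer
  fix r s :: real and f :: "real \<Rightarrow> complex"
  assume "r \<le> s" and f: "loc_integrable f \<and> loc_integrable f \<and> ae_eq f f"
  have "set_integrable lborel {0..t} (\<lambda>x. cmod (f x))" for t
    using f by (auto simp: loc_integrable_def intro: set_integrable_norm)
  thus "(LINT x:{0..r}|lborel. cmod (f x)) \<le> (LINT x:{0..s}|lborel. cmod (f x))"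
    unfolding set_lebesgue_integral_def set_integrable_def using \<open>r \<le> s\<close>
    by (intro integral_mono) (auto simp: indicator_def)
qed

definition l1loc_topology :: "l1loc topology" where
  "l1loc_topology = topology (\<lambda>U. \<forall>f\<in>U. \<exists>r. \<exists>\<epsilon>>0. \<forall>g. l1_seminorm r (g - f) < \<epsilon> \<longrightarrow> g \<in> U)"

lemma openin_l1loc_topology:
  "openin l1loc_topology U \<longleftrightarrow> (\<forall>f\<in>U. \<exists>r. \<exists>\<epsilon>>0. \<forall>g. l1_seminorm r (g - f) < \<epsilon> \<longrightarrow> g \<in> U)"
proof -
  let ?L = "\<lambda>U. \<forall>f\<in>U. \<exists>r. \<exists>\<epsilon>>0. \<forall>g. l1_seminorm r (g - f) < \<epsilon> \<longrightarrow> g \<in> U"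
  have 1: "?L (U \<inter> V)" if U: "?L U" and V: "?L V" for U V
  proof
    fix f assume f: "f \<in> U \<inter> V"
    from bspec[OF U IntD1[OF f]] obtain r1 e1
      where 1: "e1 > 0" "\<And>g. l1_seminorm r1 (g - f) < e1 \<Longrightarrow> g \<in> U" by blast
    from bspec[OF V IntD2[OF f]] obtain r2 e2
      where 2: "e2 > 0" "\<And>g. l1_seminorm r2 (g - f) < e2 \<Longrightarrow> g \<in> V" by blast
    show "\<exists>r. \<exists>\<epsilon>>0. \<forall>g. l1_seminorm r (g - f) < \<epsilon> \<longrightarrow> g \<in> U \<inter> V"
    proof (rule exI[of _ "max r1 r2"], rule exI[of _ "min e1 e2"], intro conjI allI impI)
      fix g assume "l1_seminorm (max r1 r2) (g - f) < min e1 e2"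
      thus "g \<in> U \<inter> V"
        using l1_seminorm_mono[of r1 "max r1 r2" "g - f"] l1_seminorm_mono[of r2 "max r1 r2" "g - f"]
        by (intro IntI 1(2) 2(2)) simp_all
    qed (use 1(1) 2(1) in simp)
  qed
  have 2: "?L (\<Union>\<U>)" if *: "\<forall>U\<in>\<U>. ?L U" for \<U>
  proof
    fix f assume "f \<in> \<Union>\<U>"
    then obtain U where U: "U \<in> \<U>" "f \<in> U" by blast
    from bspec[OF bspec[OF * U(1)] U(2)] U(1)
    show "\<exists>r. \<exists>\<epsilon>>0. \<forall>g. l1_seminorm r (g - f) < \<epsilon> \<longrightarrow> g \<in> \<Union>\<U>" by blast
  qed
  have "istopology ?L"
    unfolding istopology_def by (intro conjI allI impI 1 2)
  thus ?thesis unfolding l1loc_topology_def by (simp add: topology_inverse')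
qed

lemma topspace_l1loc_topology [simp]: "topspace l1loc_topology = UNIV"
proof -
  have "openin l1loc_topology UNIV"
    unfolding openin_l1loc_topology by (auto intro: exI[of _ "1::real"])
  thus ?thesis by (simp add: openin_subset top.extremum_uniqueI)
qed

section \<open>Translations and modulations\<close>

lemma AE_lborel_translate:
  assumes "AE x in lborel. P x"
  shows "AE x in lborel. P (x - a :: real)"
proof -
  obtain N where N: "N \<in> null_sets lborel" "{x. \<not> P x} \<subseteq> N"
    using assms by (auto simp: eventually_ae_filter)
  have [measurable]: "N \<in> sets borel" using N by (auto simp: null_sets_def)
  have "AE x in lborel. (- a + 1 * x) \<notin> N"
    by (rule AE_borel_affine) (use N in \<open>auto intro: AE_not_in\<close>)
  thus ?thesis using N(2) by (auto elim!: eventually_mono)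
qed

text \<open>For \<open>a \<ge> 0\<close> this is the right shift, extended by \<open>0\<close> on \<open>[0,a[\<close>; for \<open>a < 0\<close> the condition
  \<open>x < a\<close> is void on the half-line, and one gets the left shift \<open>f (x + \<bar>a\<bar>)\<close>.\<close>

lift_definition translate :: "real \<Rightarrow> l1loc \<Rightarrow> l1loc" is
  "\<lambda>a f x. if x < a then 0 else f (x - a)"
proof -
  fix a :: real and f g :: "real \<Rightarrow> complex"
  assume *: "loc_integrable f \<and> loc_integrable g \<and> ae_eq f g"
  have 1: "loc_integrable (\<lambda>x. if x < a then 0 else h (x - a))" if "loc_integrable h" for h
    unfolding loc_integrable_def
  proof
    fix r
    have "integrable lborel (\<lambda>x. indicator {0..r - a} x *\<^sub>R h x)"
      using that unfolding loc_integrable_def set_integrable_def by blast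
    hence "integrable lborel (\<lambda>x. indicator {0..r - a} (- a + 1 * x) *\<^sub>R h (- a + 1 * x))"
      by (rule lborel_integrable_real_affine) simp
    hence "set_integrable lborel {a..r} (\<lambda>x. h (x - a))"
      unfolding set_integrable_def
      by (rule back_subst[where P = "integrable lborel"]) (auto simp: fun_eq_iff indicator_def)
    hence "set_integrable lborel {max 0 a..r} (\<lambda>x. h (x - a))"
      by (rule set_integrable_subset) auto
    thus "set_integrable lborel {0..r} (\<lambda>x. if x < a then 0 else h (x - a))"
      unfolding set_integrable_def
      by (rule back_subst[where P = "integrable lborel"]) (auto simp: fun_eq_iff indicator_def)
  qed
  have "ae_eq (\<lambda>x. if x < a then 0 else f (x - a)) (\<lambda>x. if x < a then 0 else g (x - a))"
    using AE_lborel_translate[of "\<lambda>x. 0 \<le> x \<longrightarrow> f x = g x" a] *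
    unfolding ae_eq_def by (auto elim!: eventually_mono)
  thus "loc_integrable (\<lambda>x. if x < a then 0 else f (x - a)) \<and>
        loc_integrable (\<lambda>x. if x < a then 0 else g (x - a)) \<and>
        ae_eq (\<lambda>x. if x < a then 0 else f (x - a)) (\<lambda>x. if x < a then 0 else g (x - a))"
    using 1 * by blast
qed

lift_definition modulate :: "real \<Rightarrow> l1loc \<Rightarrow> l1loc" is
  "\<lambda>a f x. exp (\<i> * complex_of_real (a * x)) * f x"
proof -
  fix a :: real and f g :: "real \<Rightarrow> complex"
  let ?e = "\<lambda>x. exp (\<i> * complex_of_real (a * x))"
  assume *: "loc_integrable f \<and> loc_integrable g \<and> ae_eq f g"
  have e: "?e \<in> borel_measurable lborel"
    by (auto intro!: borel_measurable_continuous_onI continuous_intros)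
  have 1: "loc_integrable (\<lambda>x. ?e x * h x)" if "loc_integrable h" for h
    unfolding loc_integrable_def
  proof
    fix r
    have i: "integrable lborel (\<lambda>x. indicator {0..r} x *\<^sub>R h x)"
      using that unfolding loc_integrable_def set_integrable_def by blast
    have "(\<lambda>x. ?e x * (indicator {0..r} x *\<^sub>R h x)) \<in> borel_measurable lborel"
      using e borel_measurable_integrable[OF i] by (rule borel_measurable_times)
    with i have "integrable lborel (\<lambda>x. ?e x * (indicator {0..r} x *\<^sub>R h x))"
      by (rule Bochner_Integration.integrable_bound) (simp add: norm_mult)
    thus "set_integrable lborel {0..r} (\<lambda>x. ?e x * h x)"
      unfolding set_integrable_def by (simp add: mult_ac)
  qed
  have "ae_eq (\<lambda>x. ?e x * f x) (\<lambda>x. ?e x * g x)"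
    using * unfolding ae_eq_def by (auto elim!: eventually_mono)
  thus "loc_integrable (\<lambda>x. ?e x * f x) \<and> loc_integrable (\<lambda>x. ?e x * g x) \<and>
        ae_eq (\<lambda>x. ?e x * f x) (\<lambda>x. ?e x * g x)"
    using 1 * by blast
qed

section \<open>Test functions\<close>

definition nth_deriv :: "nat \<Rightarrow> (real \<Rightarrow> complex) \<Rightarrow> real \<Rightarrow> complex" where
  "nth_deriv n = (\<lambda>\<psi> x. vector_derivative \<psi> (at x)) ^^ n"

definition smooth :: "(real \<Rightarrow> complex) \<Rightarrow> bool" where
  "smooth \<phi> \<longleftrightarrow> (\<forall>n x. nth_deriv n \<phi> differentiable (at x))"

definition fun_support :: "(real \<Rightarrow> complex) \<Rightarrow> real set" where
  "fun_support \<phi> = closure {x. \<phi> x \<noteq> 0}"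

definition test_functions :: "(real \<Rightarrow> complex) set" where
  "test_functions = {\<phi>. smooth \<phi> \<and> compact (fun_support \<phi>) \<and> fun_support \<phi> \<subseteq> {0<..}}"

text \<open>The topology on test functions is the usual strict inductive limit of the Frechet spaces of
  test functions supported in a fixed compact subset of \<open>]0,\<infinity>[\<close>: the finest locally convex
  topology inducing on each of them a topology coarser than uniform convergence of
  all derivatives.  The following sets form its base of absolutely convex
  neighbourhoods of \<open>0\<close>.\<close>

definition test_nbhd :: "(real \<Rightarrow> complex) set \<Rightarrow> bool" where
  "test_nbhd V \<longleftrightarrow> V \<subseteq> test_functions \<and>
     (\<forall>\<phi>\<in>V. \<forall>\<psi>\<in>V. \<forall>a b. cmod a + cmod b \<le> 1 \<longrightarrow> (\<lambda>x. a * \<phi> x + b * \<psi> x) \<in> V) \<and>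
     (\<forall>K. compact K \<and> K \<subseteq> {0<..} \<longrightarrow>
       (\<exists>n. \<exists>\<epsilon>>0. \<forall>\<phi>\<in>test_functions. fun_support \<phi> \<subseteq> K \<longrightarrow>
          (\<forall>k\<le>n. \<forall>x. cmod (nth_deriv k \<phi> x) < \<epsilon>) \<longrightarrow> \<phi> \<in> V))"

definition test_topology :: "(real \<Rightarrow> complex) topology" where
  "test_topology = topology (\<lambda>U. U \<subseteq> test_functions \<and>
     (\<forall>\<phi>\<in>U. \<exists>V. test_nbhd V \<and> (\<forall>\<psi>\<in>V. (\<lambda>x. \<phi> x + \<psi> x) \<in> U)))"

lemma test_nbhd_Int:
  assumes "test_nbhd V" "test_nbhd W"
  shows "test_nbhd (V \<inter> W)"
  unfolding test_nbhd_def
proof (intro conjI allI impI)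
  fix K :: "real set" assume K: "compact K \<and> K \<subseteq> {0<..}"
  obtain m d where m: "d > 0" "\<And>\<phi>. \<phi> \<in> test_functions \<Longrightarrow> fun_support \<phi> \<subseteq> K \<Longrightarrow>
      (\<forall>k\<le>m. \<forall>x. cmod (nth_deriv k \<phi> x) < d) \<Longrightarrow> \<phi> \<in> V"
    using assms(1) K unfolding test_nbhd_def by meson
  obtain n e where n: "e > 0" "\<And>\<phi>. \<phi> \<in> test_functions \<Longrightarrow> fun_support \<phi> \<subseteq> K \<Longrightarrow>
      (\<forall>k\<le>n. \<forall>x. cmod (nth_deriv k \<phi> x) < e) \<Longrightarrow> \<phi> \<in> W"
    using assms(2) K unfolding test_nbhd_def by meson
  show "\<exists>n. \<exists>\<epsilon>>0. \<forall>\<phi>\<in>test_functions. fun_support \<phi> \<subseteq> K \<longrightarrow>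
          (\<forall>k\<le>n. \<forall>x. cmod (nth_deriv k \<phi> x) < \<epsilon>) \<longrightarrow> \<phi> \<in> V \<inter> W"
    by (rule exI[of _ "max m n"], rule exI[of _ "min d e"]) (use m n in auto)
qed (use assms in \<open>auto simp: test_nbhd_def\<close>)

lemma openin_test_topology:
  "openin test_topology U \<longleftrightarrow> U \<subseteq> test_functions \<and>
     (\<forall>\<phi>\<in>U. \<exists>V. test_nbhd V \<and> (\<forall>\<psi>\<in>V. (\<lambda>x. \<phi> x + \<psi> x) \<in> U))"
proof -
  let ?P = "\<lambda>U \<phi>. \<exists>V. test_nbhd V \<and> (\<forall>\<psi>\<in>V. (\<lambda>x. \<phi> x + \<psi> x) \<in> U)"
  let ?L = "\<lambda>U. U \<subseteq> test_functions \<and> (\<forall>\<phi>\<in>U. ?P U \<phi>)"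
  have Int: "?P (U \<inter> W) \<phi>" if U: "?P U \<phi>" and W: "?P W \<phi>" for U W \<phi>
  proof -
    from U obtain V1 where 1: "test_nbhd V1" "\<forall>\<psi>\<in>V1. (\<lambda>x. \<phi> x + \<psi> x) \<in> U" by blast
    from W obtain V2 where 2: "test_nbhd V2" "\<forall>\<psi>\<in>V2. (\<lambda>x. \<phi> x + \<psi> x) \<in> W" by blast
    show ?thesis
      by (rule exI[of _ "V1 \<inter> V2"]) (use test_nbhd_Int[OF 1(1) 2(1)] 1(2) 2(2) in simp)
  qed
  have Un: "?P (\<Union>\<U>) \<phi>" if "U \<in> \<U>" "?P U \<phi>" for U \<U> \<phi>
  proof -
    from that(2) obtain V where V: "test_nbhd V" "\<forall>\<psi>\<in>V. (\<lambda>x. \<phi> x + \<psi> x) \<in> U" by blast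
    show ?thesis
      by (rule exI[of _ V]) (use V that(1) in \<open>simp, blast\<close>)
  qed
  have 1: "?L (U \<inter> W)" if "?L U" "?L W" for U W
  proof (intro conjI ballI)
    fix \<phi> assume \<phi>: "\<phi> \<in> U \<inter> W"
    show "?P (U \<inter> W) \<phi>"
      by (rule Int) (rule bspec[OF conjunct2[OF that(1)] IntD1[OF \<phi>]],
        rule bspec[OF conjunct2[OF that(2)] IntD2[OF \<phi>]])
  qed (use that in blast)
  have 2: "?L (\<Union>\<U>)" if *: "\<forall>U\<in>\<U>. ?L U" for \<U>
  proof (intro conjI ballI)
    fix \<phi> assume "\<phi> \<in> \<Union>\<U>"
    then obtain U where U: "U \<in> \<U>" "\<phi> \<in> U" by blast
    show "?P (\<Union>\<U>) \<phi>"
      by (rule Un[OF U(1)]) (rule bspec[OF conjunct2[OF bspec[OF * U(1)]] U(2)])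
  qed (use * in blast)
  have "istopology ?L"
    unfolding istopology_def by (rule conjI; intro allI impI) (rule 1, assumption+, rule 2, assumption)
  thus ?thesis unfolding test_topology_def by (simp add: topology_inverse')
qed

lemma nth_deriv_0 [simp]: "nth_deriv 0 \<phi> = \<phi>"
  by (simp add: nth_deriv_def)

lemma nth_deriv_Suc: "nth_deriv (Suc n) \<phi> = (\<lambda>x. vector_derivative (nth_deriv n \<phi>) (at x))"
  by (simp add: nth_deriv_def)

lemma nth_deriv_lincomb:
  assumes "smooth \<phi>" "smooth \<psi>"
  shows "nth_deriv n (\<lambda>x. a * \<phi> x + b * \<psi> x) = (\<lambda>x. a * nth_deriv n \<phi> x + b * nth_deriv n \<psi> x)"
proof (induction n)
  case (Suc n)
  have "((\<lambda>x. a * nth_deriv n \<phi> x + b * nth_deriv n \<psi> x) has_vector_derivative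
         (a * nth_deriv (Suc n) \<phi> x + b * nth_deriv (Suc n) \<psi> x)) (at x)" for x
    unfolding nth_deriv_Suc using assms
    by (intro has_vector_derivative_add has_vector_derivative_mult_right)
      (auto simp: smooth_def simp flip: vector_derivative_works)
  hence "vector_derivative (\<lambda>x. a * nth_deriv n \<phi> x + b * nth_deriv n \<psi> x) (at x)
         = a * nth_deriv (Suc n) \<phi> x + b * nth_deriv (Suc n) \<psi> x" for x
    by (rule vector_derivative_at)
  thus ?case by (subst nth_deriv_Suc) (simp add: Suc.IH)
qed simp

lemma test_functions_lincomb:
  assumes "\<phi> \<in> test_functions" "\<psi> \<in> test_functions"
  shows "(\<lambda>x. a * \<phi> x + b * \<psi> x) \<in> test_functions"
proof -
  let ?S = "fun_support (\<lambda>x. a * \<phi> x + b * \<psi> x)"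
  have "?S \<subseteq> closure ({x. \<phi> x \<noteq> 0} \<union> {x. \<psi> x \<noteq> 0})"
    unfolding fun_support_def by (rule closure_mono) auto
  hence S: "?S \<subseteq> fun_support \<phi> \<union> fun_support \<psi>"
    unfolding fun_support_def by (simp add: closure_Un)
  have "compact (fun_support \<phi> \<union> fun_support \<psi>)"
    using assms by (auto simp: test_functions_def)
  hence "compact ?S"
    using S by (metis closed_closure compact_Int_closed fun_support_def inf.absorb2)
  moreover have "smooth (\<lambda>x. a * \<phi> x + b * \<psi> x)"
    using assms by (auto simp: test_functions_def smooth_def nth_deriv_lincomb)
  ultimately show ?thesis using S assms by (auto simp: test_functions_def)
qed

lemma topspace_test_topology [simp]: "topspace test_topology = test_functions"
proof
  have "test_nbhd test_functions"
    unfolding test_nbhd_def by (auto intro: test_functions_lincomb exI[of _ "1::real"])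
  moreover have "(\<lambda>x. \<phi> x + \<psi> x) \<in> test_functions"
    if "\<phi> \<in> test_functions" "\<psi> \<in> test_functions" for \<phi> \<psi>
    using test_functions_lincomb[OF that, of 1 1] by simp
  ultimately have "openin test_topology test_functions"
    unfolding openin_test_topology by blast
  thus "test_functions \<subseteq> topspace test_topology" by (rule openin_subset)
  show "topspace test_topology \<subseteq> test_functions"
    using openin_topspace[of test_topology] unfolding openin_test_topology by blast
qed

text \<open>Hence \<open>class_of\<close> is meaningful on test functions.\<close>

lemma test_functions_loc_integrable: "\<phi> \<in> test_functions \<Longrightarrow> loc_integrable \<phi>"
proof -
  assume "\<phi> \<in> test_functions"
  hence "\<phi> differentiable (at x)" for x
    unfolding test_functions_def smooth_def using nth_deriv_0 by (metis (no_types, lifting) mem_Collect_eq)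
  hence "continuous_on {0..r} \<phi>" for r
    by (auto intro!: continuous_at_imp_continuous_on differentiable_imp_continuous_within)
  thus "loc_integrable \<phi>"
    unfolding loc_integrable_def by (auto intro: borel_integrable_atLeastAtMost')
qed

section \<open>Banach spaces of classes of functions and their bounded operators\<close>

definition norm_dist :: "l1loc set \<Rightarrow> (l1loc \<Rightarrow> real) \<Rightarrow> l1loc \<Rightarrow> l1loc \<Rightarrow> real" where
  "norm_dist E N f g = (if f \<in> E \<and> g \<in> E then N (f - g) else 0)"

abbreviation norm_topology :: "l1loc set \<Rightarrow> (l1loc \<Rightarrow> real) \<Rightarrow> l1loc topology" where
  "norm_topology E N \<equiv> Metric_space.mtopology E (norm_dist E N)"

definition normed_space :: "l1loc set \<Rightarrow> (l1loc \<Rightarrow> real) \<Rightarrow> bool" where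
  "normed_space E N \<longleftrightarrow> l1loc.subspace E \<and>
     (\<forall>f\<in>E. N f \<ge> 0) \<and> (\<forall>f\<in>E. N f = 0 \<longleftrightarrow> f = 0) \<and>
     (\<forall>f\<in>E. \<forall>c. N (scale_l1loc c f) = cmod c * N f) \<and>
     (\<forall>f\<in>E. \<forall>g\<in>E. N (f + g) \<le> N f + N g)"

lemma Metric_space_norm_dist:
  assumes "normed_space E N"
  shows "Metric_space E (norm_dist E N)"
proof -
  have sub: "l1loc.subspace E"
    and nn: "\<And>f. f \<in> E \<Longrightarrow> 0 \<le> N f" and z: "\<And>f. f \<in> E \<Longrightarrow> N f = 0 \<longleftrightarrow> f = 0"
    and sc: "\<And>f c. f \<in> E \<Longrightarrow> N (scale_l1loc c f) = cmod c * N f"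
    and tri: "\<And>f g. f \<in> E \<Longrightarrow> g \<in> E \<Longrightarrow> N (f + g) \<le> N f + N g"
    using assms by (simp_all add: normed_space_def)
  have d: "f - g \<in> E" if "f \<in> E" "g \<in> E" for f g
    using sub that by (rule l1loc.subspace_diff)
  show ?thesis
  proof
    fix f g h
    show "0 \<le> norm_dist E N f g" using nn d by (simp add: norm_dist_def)
    have "N (f - g) = N (g - f)" if "f \<in> E" "g \<in> E"
      using sc[OF d[OF that(2) that(1)], of "- 1"] by simp
    thus "norm_dist E N f g = norm_dist E N g f" by (simp add: norm_dist_def)
    show "norm_dist E N f g = 0 \<longleftrightarrow> f = g" if "f \<in> E" "g \<in> E"
      using z[OF d[OF that]] that by (simp add: norm_dist_def)
    show "norm_dist E N f h \<le> norm_dist E N f g + norm_dist E N g h"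
      if "f \<in> E" "g \<in> E" "h \<in> E"
      using tri[OF d[OF that(1,2)] d[OF that(2,3)]] that by (simp add: norm_dist_def)
  qed
qed

definition banach_space :: "l1loc set \<Rightarrow> (l1loc \<Rightarrow> real) \<Rightarrow> bool" where
  "banach_space E N \<longleftrightarrow> normed_space E N \<and> Metric_space.mcomplete E (norm_dist E N)"

definition bounded_op :: "l1loc set \<Rightarrow> (l1loc \<Rightarrow> real) \<Rightarrow> (l1loc \<Rightarrow> l1loc) \<Rightarrow> bool" where
  "bounded_op E N A \<longleftrightarrow> A ` E \<subseteq> E \<and>
     (\<forall>f\<in>E. \<forall>g\<in>E. A (f + g) = A f + A g) \<and>
     (\<forall>f\<in>E. \<forall>c. A (scale_l1loc c f) = scale_l1loc c (A f)) \<and>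
     (\<exists>C. \<forall>f\<in>E. N (A f) \<le> C * N f)"

definition op_norm :: "l1loc set \<Rightarrow> (l1loc \<Rightarrow> real) \<Rightarrow> (l1loc \<Rightarrow> l1loc) \<Rightarrow> real" where
  "op_norm E N A = Sup {N (A f) | f. f \<in> E \<and> N f \<le> 1}"

definition spec :: "l1loc set \<Rightarrow> (l1loc \<Rightarrow> real) \<Rightarrow> (l1loc \<Rightarrow> l1loc) \<Rightarrow> complex set" where
  "spec E N A = {z. \<not> (\<exists>B. bounded_op E N B \<and>
     (\<forall>f\<in>E. B (A f - scale_l1loc z f) = f \<and> A (B f) - scale_l1loc z (B f) = f))}"

definition spec_radius :: "l1loc set \<Rightarrow> (l1loc \<Rightarrow> real) \<Rightarrow> (l1loc \<Rightarrow> l1loc) \<Rightarrow> real" where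
  "spec_radius E N A = Sup (cmod ` spec E N A)"

section \<open>The hypotheses on the space\<close>

text \<open>The inclusion of \<open>E\<close> in the space of locally integrable functions is part of its type.\<close>

definition H1 :: "l1loc set \<Rightarrow> (l1loc \<Rightarrow> real) \<Rightarrow> bool" where
  "H1 E N \<longleftrightarrow> class_of ` test_functions \<subseteq> E \<and>
     continuous_map test_topology (norm_topology E N) class_of \<and>
     continuous_map (norm_topology E N) l1loc_topology (\<lambda>f. f) \<and>
     norm_topology E N closure_of (class_of ` test_functions) = E"

text \<open>Bundling boundedness of each operator makes the real-valued supremum \<open>op_norm\<close> meaningful.\<close>

definition H2 :: "l1loc set \<Rightarrow> (l1loc \<Rightarrow> real) \<Rightarrow> bool" where
  "H2 E N \<longleftrightarrow> (\<forall>x. bounded_op E N (translate x)) \<and>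
     (\<forall>K. compact K \<longrightarrow> bdd_above ((\<lambda>x. op_norm E N (translate x)) ` K))"

definition H3 :: "l1loc set \<Rightarrow> (l1loc \<Rightarrow> real) \<Rightarrow> bool" where
  "H3 E N \<longleftrightarrow> (\<forall>a. bounded_op E N (modulate a)) \<and>
     bdd_above (range (\<lambda>a. op_norm E N (modulate a)))"

end

theory Submission
  imports Defs "HOL-Computational_Algebra.Polynomial"
begin

text \<open>The modulations conjugate \<open>A = S\<close> or \<open>A = S\<^bsub>-1\<^esub>\<close> to each of its rotations, so if
  \<open>z \<noteq> 0\<close> is not in the spectrum then the resolvent is bounded and Lipschitz on the
  whole circle through \<open>z\<close>.  Its Riemann sums over the \<open>2 ^ k\<close>-th roots of unity are the
  inverses \<open>T\<^sub>k\<close> of \<open>1 - (A / z) ^ 2 ^ k\<close>, which therefore converge in operator norm.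
  The limit is the identity: for \<open>S\<close> because \<open>T\<^sub>k f\<close> agrees with \<open>f\<close> on
  \<open>[0, 2 ^ k[\<close>, for \<open>S\<^bsub>-1\<^esub>\<close> because \<open>T\<^sub>k f = f\<close> for a test function \<open>f\<close> and large
  \<open>k\<close>.  Hence some power of \<open>A / z\<close> has norm at most \<open>1/2\<close>, and the spectral radius
  is less than \<open>\<bar>z\<bar>\<close>.  So, apart from \<open>0\<close>, both spectra are discs.  Their radii are positive
  because the powers of \<open>S\<close> and \<open>S\<^bsub>-1\<^esub>\<close> satisfy \<open>S\<^bsub>-n\<^esub> S\<^bsub>n\<^esub> = 1\<close>.\<close>

section \<open>Locally integrable functions on the half-line\<close>

lemma class_of_eq_iff:
  assumes "loc_integrable f" "loc_integrable g"
  shows "class_of f = class_of g \<longleftrightarrow> ae_eq f g"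
  using Quotient_rel[OF Quotient_l1loc, of f g] assms by (auto simp: ae_eq_def)

lemma zero_l1loc_class_of: "0 = class_of (\<lambda>_. 0)"
  by (simp add: zero_l1loc_def)

lemma loc_integrable_cmod:
  "loc_integrable f \<Longrightarrow> integrable lborel (\<lambda>x. indicator {0..r} x * cmod (f x))"
  using set_integrable_norm[of lborel "{0..r}" f] by (simp add: loc_integrable_def set_integrable_def)

lemma loc_integrable_add: "loc_integrable f \<Longrightarrow> loc_integrable g \<Longrightarrow> loc_integrable (\<lambda>x. f x + g x)"
  by (simp add: loc_integrable_def set_integral_add(1))

lemma l1_seminorm_nonneg: "0 \<le> l1_seminorm r f"
  by transfer (auto simp: set_lebesgue_integral_def intro!: integral_nonneg_AE)

lemma l1_seminorm_zero [simp]: "l1_seminorm r 0 = 0"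
  by transfer (simp add: set_lebesgue_integral_def)

lemma l1_seminorm_minus: "l1_seminorm r (- f) = l1_seminorm r f"
  by transfer simp

lemma l1_seminorm_triangle: "l1_seminorm r (f + g) \<le> l1_seminorm r f + l1_seminorm r g"
proof transfer
  fix r and f g :: "real \<Rightarrow> complex"
  assume f: "loc_integrable f \<and> loc_integrable f \<and> ae_eq f f"
    and g: "loc_integrable g \<and> loc_integrable g \<and> ae_eq g g"
  note i = loc_integrable_cmod[of f r] loc_integrable_cmod[of g r]
    loc_integrable_cmod[OF loc_integrable_add[of f g], of r]
  have "(LINT x|lborel. indicator {0..r} x * cmod (f x + g x)) \<le>
      (LINT x|lborel. indicator {0..r} x * cmod (f x) + indicator {0..r} x * cmod (g x))"
    using f g i by (intro integral_mono) (auto simp: indicator_def norm_triangle_ineq)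
  also have "\<dots> = (LINT x|lborel. indicator {0..r} x * cmod (f x)) +
      (LINT x|lborel. indicator {0..r} x * cmod (g x))"
    using f g i by (intro Bochner_Integration.integral_add) auto
  finally show "(LINT x:{0..r}|lborel. cmod (f x + g x)) \<le>
      (LINT x:{0..r}|lborel. cmod (f x)) + (LINT x:{0..r}|lborel. cmod (g x))"
    by (simp add: set_lebesgue_integral_def)
qed

lemma l1_seminorm_triangle_diff:
  "l1_seminorm r (f - h) \<le> l1_seminorm r (f - g) + l1_seminorm r (g - h)"
  using l1_seminorm_triangle[of r "f - g" "g - h"] by simp

text \<open>The right shift uses this to identify a limit in \<open>E\<close> with a given class.
  Integer radii suffice, which leaves only countably many null sets to collect.\<close>

lemma l1_seminorm_eq_0_iff: "(\<forall>r. l1_seminorm r f = 0) \<longleftrightarrow> f = 0"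
proof
  show "f = 0" if "\<forall>r. l1_seminorm r f = 0"
    using that
  proof transfer
    fix f :: "real \<Rightarrow> complex"
    assume f: "loc_integrable f \<and> loc_integrable f \<and> ae_eq f f"
      and 0: "\<forall>r. (LINT x:{0..r}|lborel. cmod (f x)) = 0"
    have "AE x in lborel. \<forall>n::nat. indicator {0..real n} x * cmod (f x) = 0"
      unfolding AE_all_countable
    proof
      fix n :: nat
      have "(LINT x|lborel. indicator {0..real n} x * cmod (f x)) = 0"
        using 0 by (simp add: set_lebesgue_integral_def)
      thus "AE x in lborel. indicator {0..real n} x * cmod (f x) = 0"
        using f loc_integrable_cmod[of f "real n"]
        by (subst (asm) integral_nonneg_eq_0_iff_AE) auto
    qed
    hence "ae_eq f (\<lambda>_. 0)"
      unfolding ae_eq_def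
    proof (rule eventually_mono, intro impI)
      fix x :: real
      assume *: "\<forall>n::nat. indicator {0..real n} x * cmod (f x) = 0" and "0 \<le> x"
      obtain n :: nat where "x \<le> real n" using real_arch_simple by blast
      thus "f x = 0" using spec[OF *, of n] \<open>0 \<le> x\<close> by simp
    qed
    thus "loc_integrable f \<and> loc_integrable (\<lambda>_. 0) \<and> ae_eq f (\<lambda>_. 0)"
      using f by (simp add: loc_integrable_def set_integrable_def)
  qed
qed simp

text \<open>This turns the topological continuity in \<open>H1\<close> into convergence of the
  seminorms, in \<open>l1_seminorm_tendsto\<close>.\<close>

lemma openin_l1loc_ball: "openin l1loc_topology {g. l1_seminorm r (g - f) < e}"
  unfolding openin_l1loc_topology
proof
  fix h assume h: "h \<in> {g. l1_seminorm r (g - f) < e}"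
  show "\<exists>s. \<exists>d>0. \<forall>g. l1_seminorm s (g - h) < d \<longrightarrow> g \<in> {g. l1_seminorm r (g - f) < e}"
  proof (rule exI[of _ r], rule exI[of _ "e - l1_seminorm r (h - f)"], intro conjI allI impI)
    fix g assume "l1_seminorm r (g - h) < e - l1_seminorm r (h - f)"
    thus "g \<in> {g. l1_seminorm r (g - f) < e}"
      using l1_seminorm_triangle_diff[of r g f h] by simp
  qed (use h in simp)
qed

section \<open>Translations and modulations\<close>

text \<open>This and the next two facts are read off from the respectfulness theorems of the lifted
  operations, applied to a pair of equal representatives.\<close>

lemma loc_integrable_translate:
  "loc_integrable f \<Longrightarrow> loc_integrable (\<lambda>x. if x < a then 0 else f (x - a))"
  using translate.rsp by (auto simp: rel_fun_def ae_eq_def)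

lemma loc_integrable_modulate:
  "loc_integrable f \<Longrightarrow> loc_integrable (\<lambda>x. exp (\<i> * complex_of_real (a * x)) * f x)"
  using modulate.rsp by (auto simp: rel_fun_def ae_eq_def)

lemma loc_integrable_scale: "loc_integrable f \<Longrightarrow> loc_integrable (\<lambda>x. c * f x)"
  using scale_l1loc.rsp by (auto simp: rel_fun_def ae_eq_def)

lemma l1_seminorm_translate:
  "0 \<le> a \<Longrightarrow> l1_seminorm (r + a) (translate a f) = l1_seminorm r f"
proof transfer
  fix a r :: real and f :: "real \<Rightarrow> complex"
  assume a: "0 \<le> a"
  assume "loc_integrable f \<and> loc_integrable f \<and> ae_eq f f"
  let ?g = "\<lambda>x. indicator {0..r} x * cmod (f x)"
  have "(LINT x|lborel. ?g x) = (LINT x|lborel. ?g (- a + 1 * x))"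
    using lborel_integral_real_affine[of 1 ?g "- a"] by simp
  also have "(\<lambda>x. ?g (- a + 1 * x)) =
      (\<lambda>x. indicator {0..r + a} x * cmod (if x < a then 0 else f (x - a)))"
    using a by (auto simp: fun_eq_iff indicator_def)
  finally show "(LINT x:{0..r + a}|lborel. cmod (if x < a then 0 else f (x - a))) =
      (LINT x:{0..r}|lborel. cmod (f x))"
    by (simp add: set_lebesgue_integral_def)
qed

text \<open>Each shift lengthens the interval of integration by 1 without changing the integral,
  which therefore equals the integral over the single point of \<open>{0..0}\<close>. In other
  words, \<open>S^n f\<close> vanishes on \<open>[0, n]\<close>.\<close>

lemma translate_funpow_seminorm: "l1_seminorm (real n) ((translate 1 ^^ n) f) = 0"
proof -
  have "l1_seminorm (real n) ((translate 1 ^^ n) f) = l1_seminorm 0 f"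
  proof (induction n)
    case (Suc n)
    thus ?case using l1_seminorm_translate[of 1 "real n" "(translate 1 ^^ n) f"] by (simp add: add.commute)
  qed simp
  also have "\<dots> = 0"
  proof transfer
    fix f :: "real \<Rightarrow> complex"
    have "AE x in lborel. indicator {0::real..0} x *\<^sub>R cmod (f x) = 0"
      by (rule eventually_mono[OF AE_lborel_singleton[of "0::real"]]) (auto simp: indicator_def)
    thus "(LINT x:{0..0}|lborel. cmod (f x)) = 0"
      unfolding set_lebesgue_integral_def by (rule integral_eq_zero_AE)
  qed
  finally show ?thesis .
qed

text \<open>Only this order of composition gives the identity: shifting left first discards
  \<open>f\<close> on \<open>[0, 1[\<close>. The one-sided inverse later bounds the powers of both
  shifts from below.\<close>

lemma translate_left_inverse: "translate (-1) (translate 1 f) = f"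
proof (transfer, intro conjI)
  fix f :: "real \<Rightarrow> complex"
  assume "loc_integrable f \<and> loc_integrable f \<and> ae_eq f f"
  thus "loc_integrable (\<lambda>x. if x < -1 then 0 else if x - -1 < 1 then 0 else f (x - -1 - 1))"
    using loc_integrable_translate[OF loc_integrable_translate, of f "-1" 1] by simp
qed (auto simp: ae_eq_def)

lemma modulate_modulate: "modulate a (modulate b f) = modulate (a + b) f"
proof (transfer, intro conjI)
  fix a b and f :: "real \<Rightarrow> complex"
  assume f: "loc_integrable f \<and> loc_integrable f \<and> ae_eq f f"
  show "loc_integrable (\<lambda>x. exp (\<i> * complex_of_real (a * x)) * (exp (\<i> * complex_of_real (b * x)) * f x))"
    "loc_integrable (\<lambda>x. exp (\<i> * complex_of_real ((a + b) * x)) * f x)"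
    using f by (simp_all only: loc_integrable_modulate)
qed (auto simp: ae_eq_def distrib_right distrib_left exp_add)

lemma modulate_0 [simp]: "modulate 0 f = f"
  by transfer (auto simp: ae_eq_def)

text \<open>The commutation relation behind the rotation argument: for \<open>b = 1\<close> or
  \<open>b = -1\<close>, conjugation by \<open>modulate a\<close> multiplies the shift by
  \<open>cis a\<close> or \<open>cis (- a)\<close>.\<close>

lemma modulate_translate:
  "modulate a (translate b f) = scale_l1loc (cis (a * b)) (translate b (modulate a f))"
proof (transfer, intro conjI)
  fix a b and f :: "real \<Rightarrow> complex"
  assume f: "loc_integrable f \<and> loc_integrable f \<and> ae_eq f f"
  show "loc_integrable (\<lambda>x. exp (\<i> * complex_of_real (a * x)) * (if x < b then 0 else f (x - b)))"
    using f by (intro loc_integrable_modulate loc_integrable_translate) simp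
  show "loc_integrable (\<lambda>x. cis (a * b) *
      (if x < b then 0 else exp (\<i> * complex_of_real (a * (x - b))) * f (x - b)))"
    using f loc_integrable_scale[OF loc_integrable_translate[OF loc_integrable_modulate]] by simp
qed (auto simp: ae_eq_def cis_conv_exp algebra_simps simp flip: exp_add)

section \<open>Classes vanishing beyond a point, and the left shift\<close>

lift_definition vanishes_beyond :: "real \<Rightarrow> l1loc \<Rightarrow> bool" is
  "\<lambda>b f. AE x in lborel. 0 \<le> x \<longrightarrow> b \<le> x \<longrightarrow> f x = 0"
proof -
  fix b and f g :: "real \<Rightarrow> complex"
  assume "loc_integrable f \<and> loc_integrable g \<and> ae_eq f g"
  hence "AE x in lborel. 0 \<le> x \<longrightarrow> f x = g x" by (simp add: ae_eq_def)
  hence "AE x in lborel. (0 \<le> x \<longrightarrow> b \<le> x \<longrightarrow> f x = 0) \<longleftrightarrow> (0 \<le> x \<longrightarrow> b \<le> x \<longrightarrow> g x = 0)"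
    by (rule eventually_mono) auto
  thus "(AE x in lborel. 0 \<le> x \<longrightarrow> b \<le> x \<longrightarrow> f x = 0) \<longleftrightarrow>
      (AE x in lborel. 0 \<le> x \<longrightarrow> b \<le> x \<longrightarrow> g x = 0)"
    by (rule eventually_subst)
qed

lemma vanishes_beyond_translate:
  "vanishes_beyond b f \<Longrightarrow> vanishes_beyond (b - 1) (translate (- 1) f)"
proof transfer
  fix b and f :: "real \<Rightarrow> complex"
  assume "AE x in lborel. 0 \<le> x \<longrightarrow> b \<le> x \<longrightarrow> f x = 0"
  from AE_lborel_translate[OF this, of "-1"]
  show "AE x in lborel. 0 \<le> x \<longrightarrow> b - 1 \<le> x \<longrightarrow> (if x < - 1 then 0 else f (x - - 1)) = 0"
    by (rule eventually_mono) auto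
qed

lemma vanishes_beyond_nonpos: "vanishes_beyond b f \<Longrightarrow> b \<le> 0 \<Longrightarrow> f = 0"
  by transfer (auto simp: ae_eq_def loc_integrable_def set_integrable_def elim: eventually_mono)

text \<open>Each left shift lowers the bound by 1; once the bound is at most 0, nothing is left on
  the half-line.\<close>

lemma vanishes_beyond_funpow_translate:
  assumes "vanishes_beyond b f" "b \<le> real n"
  shows "(translate (- 1) ^^ n) f = 0"
proof -
  have "vanishes_beyond (b - real n) ((translate (- 1) ^^ n) f)" for n
  proof (induction n)
    case (Suc n)
    have "b - real (Suc n) = b - real n - 1" by simp
    thus ?case using vanishes_beyond_translate[OF Suc.IH] by (simp only: funpow.simps comp_apply)
  qed (use assms in simp)
  from vanishes_beyond_nonpos[OF this[of n]] assms(2) show ?thesis by simp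
qed

lemma test_function_vanishes_beyond:
  assumes "\<phi> \<in> test_functions"
  obtains b where "vanishes_beyond b (class_of \<phi>)"
proof -
  have "bounded (fun_support \<phi>)" using assms by (simp add: test_functions_def compact_imp_bounded)
  then obtain b where b: "\<And>x. x \<in> fun_support \<phi> \<Longrightarrow> \<bar>x\<bar> \<le> b" by (auto simp: bounded_iff)
  have "\<phi> x = 0" if "b + 1 \<le> x" for x
    using b[of x] that closure_subset[of "{x. \<phi> x \<noteq> 0}"] by (fastforce simp: fun_support_def)
  hence "vanishes_beyond (b + 1) (class_of \<phi>)"
    using test_functions_loc_integrable[OF assms] by (simp add: vanishes_beyond.abs_eq ae_eq_def)
  thus ?thesis by (rule that)
qed

section \<open>A nonzero test function\<close>

text \<open>All iterated derivatives stay in a class \<open>C\<close> closed under differentiation,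
  so smoothness follows without a formula for the \<open>n\<close>-th derivative.\<close>

lemma smoothI:
  assumes "\<phi> \<in> C" and "\<And>\<psi>. \<psi> \<in> C \<Longrightarrow> \<exists>\<psi>'\<in>C. \<forall>x. (\<psi> has_vector_derivative \<psi>' x) (at x)"
  shows "smooth \<phi>"
proof -
  have *: "nth_deriv n \<phi> \<in> C" for n
  proof (induction n)
    case (Suc n)
    obtain \<psi>' where \<psi>': "\<psi>' \<in> C" "\<And>x. (nth_deriv n \<phi> has_vector_derivative \<psi>' x) (at x)"
      using assms(2)[OF Suc.IH] by blast
    hence "nth_deriv (Suc n) \<phi> = \<psi>'" by (auto simp: nth_deriv_Suc fun_eq_iff intro: vector_derivative_at)
    thus ?case using \<psi>'(1) by simp
  qed (use assms(1) in simp)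
  show ?thesis
    unfolding smooth_def using assms(2)[OF *] by (meson differentiableI_vector)
qed

lemma poly_times_exp_minus_tendsto_0: "((\<lambda>x::real. poly p x * exp (- x)) \<longlongrightarrow> 0) at_top"
proof -
  have "((\<lambda>x::real. \<Sum>i\<le>degree p. coeff p i * (x ^ i / exp x)) \<longlongrightarrow> (\<Sum>i\<le>degree p. coeff p i * 0)) at_top"
    by (intro tendsto_intros tendsto_power_div_exp_0)
  thus ?thesis by (simp add: poly_altdef sum_distrib_right exp_minus divide_inverse mult.assoc)
qed

text \<open>With \<open>t = 1 / x\<close> this is \<open>p(t) e^{-t}\<close>. Letting
  \<open>p\<close> vary makes the family closed under differentiation; \<open>p = 1\<close> is the
  classical flat function.\<close>

definition flat :: "real poly \<Rightarrow> real \<Rightarrow> real" where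
  "flat p x = (if 0 < x then poly p (1 / x) * exp (- (1 / x)) else 0)"

text \<open>Since \<open>dt/dx = - t^2\<close>, differentiating \<open>p(t) e^{-t}\<close> in
  \<open>x\<close> gives \<open>t^2 (p - p')(t) e^{-t}\<close>.\<close>

definition flat_deriv :: "real poly \<Rightarrow> real poly" where
  "flat_deriv p = [:0, 0, 1:] * (p - pderiv p)"

lemma flat_has_deriv: "(flat p has_real_derivative flat (flat_deriv p) x) (at x)"
proof -
  consider "x < 0" | "x > 0" | "x = 0" by linarith
  thus ?thesis
  proof cases
    case 1
    have "((\<lambda>_. 0) has_real_derivative 0) (at x)" by simp
    hence "(flat p has_real_derivative 0) (at x)"
      by (rule has_field_derivative_transform_within_open[of _ _ _ "{..<0}"]) (use 1 in \<open>auto simp: flat_def\<close>)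
    thus ?thesis using 1 by (simp add: flat_def)
  next
    case 2
    have "((\<lambda>x. poly p (1 / x) * exp (- (1 / x))) has_real_derivative flat (flat_deriv p) x) (at x)"
      using 2 by (auto intro!: derivative_eq_intros simp: flat_def flat_deriv_def field_simps power2_eq_square)
    thus ?thesis
      by (rule has_field_derivative_transform_within_open[of _ _ _ "{0<..}"]) (use 2 in \<open>auto simp: flat_def\<close>)
  next
    case 3
    \<comment> \<open>The difference quotient at 0 from the right is \<open>t p(t) e^{-t}\<close>,
      whence the factor \<open>[:0, 1:]\<close>.\<close>
    have "((\<lambda>x. poly ([:0, 1:] * p) (inverse x) * exp (- inverse x)) \<longlongrightarrow> 0) (at_right (0::real))"
      using filterlim_compose[OF poly_times_exp_minus_tendsto_0 filterlim_inverse_at_top_right] .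
    hence r: "((\<lambda>x. flat p x / x) \<longlongrightarrow> 0) (at_right 0)"
      by (rule Lim_transform_eventually)
        (auto simp: eventually_at_right_less flat_def field_simps intro!: eventually_at_rightI[of 0 1])
    have l: "((\<lambda>x. flat p x / x) \<longlongrightarrow> 0) (at_left 0)"
      by (rule Lim_transform_eventually[OF tendsto_const])
        (auto simp: flat_def intro!: eventually_at_leftI[of "-1" 0])
    have "((\<lambda>x. flat p x / x) \<longlongrightarrow> 0) (at 0)" using filterlim_split_at[OF l r] .
    thus ?thesis using 3 by (simp add: has_field_derivative_iff flat_def)
  qed
qed

definition bump :: "real poly \<Rightarrow> real poly \<Rightarrow> real \<Rightarrow> complex" where
  "bump p q x = of_real (flat p (x - 1) * flat q (2 - x))"

text \<open>The product rule turns one bump into a sum of two, so closure under differentiation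
  requires sums. The sign produced by the reflection \<open>2 - x\<close> is absorbed into the
  polynomial as \<open>- p\<close>.\<close>

inductive_set bump_sums :: "(real \<Rightarrow> complex) set" where
  bump: "bump p q \<in> bump_sums"
| add: "f \<in> bump_sums \<Longrightarrow> g \<in> bump_sums \<Longrightarrow> (\<lambda>x. f x + g x) \<in> bump_sums"

lemma bump_sums_derivative:
  "f \<in> bump_sums \<Longrightarrow> \<exists>g\<in>bump_sums. \<forall>x. (f has_vector_derivative g x) (at x)"
proof (induction rule: bump_sums.induct)
  case (bump p q)
  have "(bump p q has_vector_derivative (bump (flat_deriv p) q x + bump (- p) (flat_deriv q) x)) (at x)" for x
  proof -
    have d: "((\<lambda>x. x - 1) has_real_derivative 1) (at x)" "((\<lambda>x. 2 - x) has_real_derivative - 1) (at x)"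
      by (auto intro!: derivative_eq_intros)
    have "((\<lambda>x. flat p (x - 1)) has_real_derivative flat (flat_deriv p) (x - 1) * 1) (at x)"
      "((\<lambda>x. flat q (2 - x)) has_real_derivative flat (flat_deriv q) (2 - x) * - 1) (at x)"
      by (rule DERIV_chain2[OF flat_has_deriv d(1)], rule DERIV_chain2[OF flat_has_deriv d(2)])
    hence "((\<lambda>x. flat p (x - 1) * flat q (2 - x)) has_real_derivative
        flat (flat_deriv p) (x - 1) * flat q (2 - x) +
        flat (- p) (x - 1) * flat (flat_deriv q) (2 - x)) (at x)"
      by (auto intro!: derivative_eq_intros simp: flat_def)
    from has_vector_derivative_of_real[OF this] show ?thesis
      by (simp add: bump_def[abs_def])
  qed
  thus ?case by (intro bexI[of _ "\<lambda>x. bump (flat_deriv p) q x + bump (- p) (flat_deriv q) x"])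
      (auto intro: bump_sums.intros)
next
  case (add f g)
  then obtain f' g' where "f' \<in> bump_sums" "\<forall>x. (f has_vector_derivative f' x) (at x)"
    "g' \<in> bump_sums" "\<forall>x. (g has_vector_derivative g' x) (at x)" by blast
  thus ?case
    by (intro bexI[of _ "\<lambda>x. f' x + g' x"]) (auto intro: bump_sums.add has_vector_derivative_add)
qed

lemma bump_nonzero_iff: "bump 1 1 x \<noteq> 0 \<longleftrightarrow> x \<in> {1<..<2}"
  by (auto simp: bump_def flat_def)

lemma bump_test_function: "bump 1 1 \<in> test_functions"
proof -
  have "{x. bump 1 1 x \<noteq> 0} = {1<..<2}" using bump_nonzero_iff by blast
  hence "fun_support (bump 1 1) = {1..2}" by (simp add: fun_support_def)
  moreover have "smooth (bump 1 1)"
    by (rule smoothI[OF bump_sums.bump]) (rule bump_sums_derivative)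
  ultimately show ?thesis by (auto simp: test_functions_def)
qed

lemma class_of_bump_nonzero: "class_of (bump 1 1) \<noteq> 0"
proof
  assume "class_of (bump 1 1) = 0"
  hence "ae_eq (bump 1 1) (\<lambda>_. 0)"
    using test_functions_loc_integrable[OF bump_test_function]
    by (simp add: zero_l1loc_class_of class_of_eq_iff loc_integrable_def set_integrable_def)
  hence "AE x in lborel. x \<notin> {1<..<2::real}"
    unfolding ae_eq_def by (rule eventually_mono) (use bump_nonzero_iff in fastforce)
  hence "emeasure lborel {1<..<2::real} = 0"
    by (subst (asm) AE_iff_null_sets[symmetric]) (auto simp: null_sets_def)
  thus False by simp
qed

section \<open>Bounded operators and their spectra\<close>

locale l1loc_banach =
  fixes E :: "l1loc set" and N :: "l1loc \<Rightarrow> real"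
  assumes banach: "banach_space E N"
begin

lemma normed: "normed_space E N"
  using banach by (simp add: banach_space_def)

sublocale Metric_space E "norm_dist E N"
  by (rule Metric_space_norm_dist[OF normed])

lemma subspace: "l1loc.subspace E"
  and N_nonneg: "f \<in> E \<Longrightarrow> 0 \<le> N f"
  and N_eq_0_iff: "f \<in> E \<Longrightarrow> N f = 0 \<longleftrightarrow> f = 0"
  and N_scale: "f \<in> E \<Longrightarrow> N (scale_l1loc c f) = cmod c * N f"
  and N_triangle: "f \<in> E \<Longrightarrow> g \<in> E \<Longrightarrow> N (f + g) \<le> N f + N g"
  using normed by (simp_all add: normed_space_def)

lemma E_zero [simp]: "0 \<in> E"
  and E_add [simp]: "f \<in> E \<Longrightarrow> g \<in> E \<Longrightarrow> f + g \<in> E"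
  and E_diff [simp]: "f \<in> E \<Longrightarrow> g \<in> E \<Longrightarrow> f - g \<in> E"
  and E_minus [simp]: "f \<in> E \<Longrightarrow> - f \<in> E"
  and E_scale [simp]: "f \<in> E \<Longrightarrow> scale_l1loc c f \<in> E"
  using subspace by (simp_all add: l1loc.subspace_0 l1loc.subspace_add l1loc.subspace_diff
      l1loc.subspace_neg l1loc.subspace_scale)

lemma N_zero [simp]: "N 0 = 0"
  using N_eq_0_iff[of 0] by simp

lemma N_minus: "f \<in> E \<Longrightarrow> N (- f) = N f"
  using N_scale[of f "-1"] by simp

lemma N_diff_commute: "f \<in> E \<Longrightarrow> g \<in> E \<Longrightarrow> N (f - g) = N (g - f)"
  using N_minus[of "f - g"] by simp

lemma N_triangle_diff: "f \<in> E \<Longrightarrow> g \<in> E \<Longrightarrow> N (f - g) \<le> N f + N g"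
  using N_triangle[of f "- g"] by (simp add: N_minus)

lemma N_triangle_diff': "f \<in> E \<Longrightarrow> g \<in> E \<Longrightarrow> N f \<le> N (f - g) + N g"
  using N_triangle[of "f - g" g] by simp

lemma N_triangle3: "f \<in> E \<Longrightarrow> g \<in> E \<Longrightarrow> h \<in> E \<Longrightarrow> N (f - h) \<le> N (f - g) + N (g - h)"
  using N_triangle[of "f - g" "g - h"] by simp

lemma N_average:
  assumes "f \<in> E" "g \<in> E" "N f \<le> c" "N g \<le> c"
  shows "N (scale_l1loc (1/2) (f + g)) \<le> c"
  using N_triangle[OF assms(1,2)] assms by (simp add: N_scale norm_divide)

lemma geometric_increments:
  assumes x: "\<And>n. x n \<in> E" and inc: "\<And>n. N (x n - x (Suc n)) \<le> c * q ^ n"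
    and q: "0 \<le> q" "q < 1" and "m \<le> n"
  shows "N (x m - x n) \<le> c * q ^ m / (1 - q)"
proof -
  have c: "0 \<le> c" using inc[of 0] N_nonneg[of "x 0 - x 1"] x by simp
  \<comment> \<open>The induction needs the exact partial sum of the geometric series; its negative
    term is dropped only at the end.\<close>
  have "N (x m - x (m + d)) \<le> c * (q ^ m - q ^ (m + d)) / (1 - q)" for d
  proof (induction d)
    case (Suc d)
    have "N (x m - x (m + Suc d)) \<le> N (x m - x (m + d)) + N (x (m + d) - x (m + Suc d))"
      using x by (intro N_triangle3)
    also have "\<dots> \<le> c * (q ^ m - q ^ (m + d)) / (1 - q) + c * q ^ (m + d)"
      using Suc.IH inc[of "m + d"] by simp
    also have "\<dots> = c * (q ^ m - q ^ (m + Suc d)) / (1 - q)"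
      using q by (simp add: field_simps)
    finally show ?case .
  qed simp
  from this[of "n - m"] \<open>m \<le> n\<close>
  have "N (x m - x n) \<le> c * (q ^ m - q ^ n) / (1 - q)" by simp
  also have "\<dots> \<le> c * q ^ m / (1 - q)"
    using c q by (intro divide_right_mono mult_left_mono) auto
  finally show ?thesis .
qed

lemma geometric_increments_convergent:
  assumes x: "\<And>n. x n \<in> E" and inc: "\<And>n. N (x n - x (Suc n)) \<le> c * q ^ n"
    and q: "0 \<le> q" "q < 1"
  obtains l where "l \<in> E" "(\<lambda>n. N (x n - l)) \<longlonglongrightarrow> 0"
proof -
  have lim: "(\<lambda>n. c * q ^ n / (1 - q)) \<longlonglongrightarrow> 0"
    using tendsto_mult_right[OF LIMSEQ_realpow_zero[OF q], of "c / (1 - q)"] by (simp add: mult.commute)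
  have "MCauchy x"
    unfolding MCauchy_def
  proof (intro conjI allI impI)
    fix e :: real assume "0 < e"
    then obtain n0 where n0: "\<And>n. n \<ge> n0 \<Longrightarrow> c * q ^ n / (1 - q) < e"
      using order_tendstoD(2)[OF lim] by (auto simp: eventually_sequentially)
    show "\<exists>n0. \<forall>m n. n0 \<le> m \<longrightarrow> n0 \<le> n \<longrightarrow> norm_dist E N (x m) (x n) < e"
    proof (intro exI[of _ n0] allI impI)
      fix m n assume mn: "n0 \<le> m" "n0 \<le> n"
      have *: "N (x i - x j) < e" if "n0 \<le> i" "i \<le> j" for i j
        using geometric_increments[OF x inc q that(2)] n0[OF that(1)] by simp
      show "norm_dist E N (x m) (x n) < e"
        using *[of m n] *[of n m] mn x N_diff_commute[of "x m" "x n"]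
        by (cases "m \<le> n") (auto simp: norm_dist_def)
    qed
  qed (use x in auto)
  then obtain l where "limitin mtopology x l sequentially"
    using banach unfolding banach_space_def mcomplete_def by blast
  thus ?thesis using that x by (auto simp: limitin_metric_dist_null norm_dist_def)
qed

section \<open>Algebra of bounded operators\<close>

abbreviation bop :: "(l1loc \<Rightarrow> l1loc) \<Rightarrow> bool" where
  "bop \<equiv> bounded_op E N"

lemma bopI:
  assumes "\<And>f. f \<in> E \<Longrightarrow> A f \<in> E" "\<And>f g. f \<in> E \<Longrightarrow> g \<in> E \<Longrightarrow> A (f + g) = A f + A g"
    "\<And>f c. f \<in> E \<Longrightarrow> A (scale_l1loc c f) = scale_l1loc c (A f)"
    "\<And>f. f \<in> E \<Longrightarrow> N (A f) \<le> C * N f"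
  shows "bop A"
  using assms unfolding bounded_op_def by blast

lemma bop_closed: "bop A \<Longrightarrow> f \<in> E \<Longrightarrow> A f \<in> E"
  and bop_add: "bop A \<Longrightarrow> f \<in> E \<Longrightarrow> g \<in> E \<Longrightarrow> A (f + g) = A f + A g"
  and bop_scale: "bop A \<Longrightarrow> f \<in> E \<Longrightarrow> A (scale_l1loc c f) = scale_l1loc c (A f)"
  unfolding bounded_op_def by blast+

lemma bop_diff: "bop A \<Longrightarrow> f \<in> E \<Longrightarrow> g \<in> E \<Longrightarrow> A (f - g) = A f - A g"
  using bop_add[of A f "scale_l1loc (-1) g"] bop_scale[of A g "-1"] by simp

text \<open>The constant is made positive so that it can multiply inequalities and be divided
  by.\<close>

lemma bop_bound:
  assumes "bop A"
  obtains C where "0 < C" "\<And>f. f \<in> E \<Longrightarrow> N (A f) \<le> C * N f"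
proof -
  obtain C where C: "\<And>f. f \<in> E \<Longrightarrow> N (A f) \<le> C * N f"
    using assms unfolding bounded_op_def by blast
  show ?thesis
  proof (rule that[of "max C 1"])
    show "N (A f) \<le> max C 1 * N f" if "f \<in> E" for f
      using C[OF that] mult_right_mono[OF max.cobounded1 N_nonneg[OF that], of C 1] by simp
  qed simp
qed

lemma bop_id: "bop (\<lambda>f. f)"
  by (rule bopI[where C = 1]) auto

lemma bop_zero: "bop (\<lambda>f. 0)"
  by (rule bopI[where C = 0]) auto

lemma bop_comp:
  assumes "bop A" "bop B"
  shows "bop (\<lambda>f. A (B f))"
proof -
  obtain C where C: "0 < C" "\<And>f. f \<in> E \<Longrightarrow> N (A f) \<le> C * N f" by (rule bop_bound[OF assms(1)]) blast
  obtain D where D: "\<And>f. f \<in> E \<Longrightarrow> N (B f) \<le> D * N f" by (rule bop_bound[OF assms(2)]) blast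
  show ?thesis
  proof (rule bopI[where C = "C * D"])
    fix f assume f: "f \<in> E"
    have "N (A (B f)) \<le> C * N (B f)" using C f assms by (simp add: bop_closed)
    also have "\<dots> \<le> C * (D * N f)" using D[OF f] C(1) by simp
    finally show "N (A (B f)) \<le> C * D * N f" by simp
  qed (use assms in \<open>simp_all add: bop_closed bop_add bop_scale\<close>)
qed

lemma bop_plus:
  assumes "bop A" "bop B"
  shows "bop (\<lambda>f. A f + B f)"
proof -
  obtain C where C: "\<And>f. f \<in> E \<Longrightarrow> N (A f) \<le> C * N f" by (rule bop_bound[OF assms(1)]) blast
  obtain D where D: "\<And>f. f \<in> E \<Longrightarrow> N (B f) \<le> D * N f" by (rule bop_bound[OF assms(2)]) blast
  show ?thesis
  proof (rule bopI[where C = "C + D"])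
    fix f assume f: "f \<in> E"
    show "N (A f + B f) \<le> (C + D) * N f"
      using N_triangle[of "A f" "B f"] C[OF f] D[OF f] f assms by (simp add: bop_closed distrib_right)
  qed (use assms in \<open>simp_all add: bop_closed bop_add bop_scale l1loc.scale_right_distrib\<close>)
qed

lemma bop_scaled:
  assumes "bop A"
  shows "bop (\<lambda>f. scale_l1loc c (A f))"
proof -
  obtain C where C: "\<And>f. f \<in> E \<Longrightarrow> N (A f) \<le> C * N f" by (rule bop_bound[OF assms]) blast
  show ?thesis
  proof (rule bopI[where C = "cmod c * C"])
    fix f assume f: "f \<in> E"
    show "N (scale_l1loc c (A f)) \<le> cmod c * C * N f"
      using mult_left_mono[OF C[OF f], of "cmod c"] f assms by (simp add: N_scale bop_closed mult.assoc)
  qed (use assms in \<open>simp_all add: bop_closed bop_add bop_scale l1loc.scale_right_distrib mult.commute\<close>)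
qed

lemma bop_funpow: "bop A \<Longrightarrow> bop (A ^^ n)"
  by (induction n) (simp_all add: bop_id bop_comp id_def comp_def)

lemma funpow_bound:
  assumes "bop A" "0 \<le> C" "\<And>f. f \<in> E \<Longrightarrow> N (A f) \<le> C * N f" "f \<in> E"
  shows "N ((A ^^ n) f) \<le> C ^ n * N f"
proof (induction n)
  case (Suc n)
  have "N (A ((A ^^ n) f)) \<le> C * N ((A ^^ n) f)"
    using assms by (simp add: bop_closed[OF bop_funpow])
  also have "\<dots> \<le> C * (C ^ n * N f)" using Suc.IH assms(2) by (rule mult_left_mono)
  finally show ?case by (simp add: mult.assoc)
qed simp

section \<open>Resolvents, the Neumann argument and powers\<close>

lemma notin_specD:
  assumes "z \<notin> spec E N A"
  obtains B where "bop B" "\<And>f. f \<in> E \<Longrightarrow> B (A f - scale_l1loc z f) = f"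
    "\<And>f. f \<in> E \<Longrightarrow> A (B f) - scale_l1loc z (B f) = f"
  using assms unfolding spec_def by blast

text \<open>An operator bounded below is injective. This makes the right inverse, which is chosen
  pointwise, linear and two-sided, and the lower bound \<open>c\<close> bounds it by
  \<open>1 / c\<close>.\<close>

lemma notin_specI:
  assumes A: "bop A" and "0 < c" and below: "\<And>f. f \<in> E \<Longrightarrow> c * N f \<le> N (A f - scale_l1loc z f)"
    and surj: "\<And>f. f \<in> E \<Longrightarrow> \<exists>g\<in>E. A g - scale_l1loc z g = f"
  shows "z \<notin> spec E N A"
proof -
  let ?L = "\<lambda>f. A f - scale_l1loc z f"
  obtain B where B: "\<And>f. f \<in> E \<Longrightarrow> B f \<in> E" "\<And>f. f \<in> E \<Longrightarrow> ?L (B f) = f"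
    using surj by metis
  have L: "bop ?L"
    using bop_plus[OF A bop_scaled[OF bop_id, of "- z"]] by simp
  have inj: "f = g" if "f \<in> E" "g \<in> E" "?L f = ?L g" for f g
  proof -
    have "c * N (f - g) \<le> N (?L f - ?L g)"
      using below[of "f - g"] that bop_diff[OF L, of f g] by simp
    hence "N (f - g) \<le> 0" using that \<open>0 < c\<close> by (simp add: mult_le_0_iff)
    thus "f = g" using that N_nonneg[of "f - g"] N_eq_0_iff[of "f - g"] by simp
  qed
  have "bop B"
  proof (rule bopI[where C = "1 / c"])
    fix f g assume fg: "f \<in> E" "g \<in> E"
    show "B (f + g) = B f + B g"
      by (rule inj) (use fg B in \<open>simp_all only: E_add bop_add[OF L]\<close>)
  next
    fix f a assume f: "f \<in> E"
    show "B (scale_l1loc a f) = scale_l1loc a (B f)"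
      by (rule inj) (use f B in \<open>simp_all only: E_scale bop_scale[OF L]\<close>)
  next
    fix f assume "f \<in> E"
    thus "N (B f) \<le> 1 / c * N f" using below[of "B f"] B \<open>0 < c\<close> by (simp add: field_simps)
  qed (use B in auto)
  moreover have "B (?L f) = f" if "f \<in> E" for f
    by (rule inj) (use that B bop_closed[OF L] in auto)
  ultimately show ?thesis using B unfolding spec_def by blast
qed

lemma spec_bounded:
  assumes A: "bop A" and c: "0 \<le> c" "\<And>f. f \<in> E \<Longrightarrow> N (A f) \<le> c * N f" and z: "c < cmod z"
  shows "z \<notin> spec E N A"
proof (rule notin_specI[OF A, of "cmod z - c"])
  show "0 < cmod z - c" using z by simp
  have z0: "z \<noteq> 0" "0 < cmod z" using z c(1) by auto
  show "(cmod z - c) * N f \<le> N (A f - scale_l1loc z f)" if f: "f \<in> E" for f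
  proof -
    have "cmod z * N f \<le> N (scale_l1loc z f - A f) + N (A f)"
      using N_triangle_diff'[of "scale_l1loc z f" "A f"] f A by (simp add: N_scale bop_closed)
    thus ?thesis
      using c(2)[OF f] N_diff_commute[of "A f" "scale_l1loc z f"] f A
      by (simp add: bop_closed algebra_simps)
  qed
  show "\<exists>g\<in>E. A g - scale_l1loc z g = f" if f: "f \<in> E" for f
  proof -
    \<comment> \<open>A fixed point of \<open>F\<close> solves \<open>A g - z g = f\<close>, and
      \<open>F\<close> contracts distances by the factor \<open>c / |z| < 1\<close>.\<close>
    define F where "F g = scale_l1loc (1 / z) (A g - f)" for g
    define x where "x n = (F ^^ n) 0" for n
    have x: "x n \<in> E" for n
      by (induction n) (use f A in \<open>simp_all add: x_def F_def bop_closed\<close>)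
    have xS: "x (Suc n) = F (x n)" for n by (simp add: x_def)
    have F: "N (F g - F h) \<le> c / cmod z * N (g - h)" if "g \<in> E" "h \<in> E" for g h
    proof -
      have "F g - F h = scale_l1loc (1 / z) (A (g - h))"
        using that by (simp add: F_def bop_diff[OF A] flip: l1loc.scale_right_diff_distrib)
      hence "N (F g - F h) = N (A (g - h)) / cmod z"
        using that A by (simp add: N_scale bop_closed norm_divide)
      thus ?thesis using c(2)[of "g - h"] that z0 by (simp add: divide_right_mono)
    qed
    have inc: "N (x n - x (Suc n)) \<le> N (x 0 - x 1) * (c / cmod z) ^ n" for n
    proof (induction n)
      case (Suc n)
      have "N (x (Suc n) - x (Suc (Suc n))) \<le> c / cmod z * N (x n - x (Suc n))"
        using F[OF x x, of n "Suc n"] by (simp add: xS)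
      also have "\<dots> \<le> c / cmod z * (N (x 0 - x 1) * (c / cmod z) ^ n)"
        using Suc.IH c(1) by (intro mult_left_mono) auto
      finally show ?case by (simp add: mult_ac)
    qed simp
    obtain l where l: "l \<in> E" "(\<lambda>n. N (x n - l)) \<longlonglongrightarrow> 0"
      by (rule geometric_increments_convergent[OF x inc]) (use c z z0 in auto)
    \<comment> \<open>Passing through \<open>x (Suc n) = F (x n)\<close> bounds
      \<open>N (F l - l)\<close> by this null sequence.\<close>
    have "(\<lambda>n. c / cmod z * N (x n - l) + N (x (Suc n) - l)) \<longlonglongrightarrow> c / cmod z * 0 + 0"
      by (intro tendsto_intros l(2) LIMSEQ_Suc[OF l(2)])
    moreover have "N (F l - l) \<le> c / cmod z * N (x n - l) + N (x (Suc n) - l)" for n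
      using N_triangle3[of "F l" "x (Suc n)" l] F[OF l(1) x, of n] l(1) x[of n] x[of "Suc n"]
        N_diff_commute[of l "x n"] f A by (simp add: xS) (simp add: F_def bop_closed)
    ultimately have "N (F l - l) \<le> 0"
      by (metis (no_types, lifting) LIMSEQ_le_const add.right_neutral mult_zero_right)
    moreover have Fl: "F l \<in> E" using f l A by (simp add: F_def bop_closed)
    ultimately have "F l = l"
      using N_nonneg[of "F l - l"] N_eq_0_iff[of "F l - l"] l(1) by simp
    hence "scale_l1loc z (F l) = scale_l1loc z l" by simp
    hence "A l - f = scale_l1loc z l" using z0 by (simp add: F_def)
    thus ?thesis using l(1) by (intro bexI[of _ l]) (auto simp: algebra_simps)
  qed
qed

text \<open>\<open>P\<close> is the sum of \<open>z^(n-1-i) A^i\<close> over \<open>i < n\<close>,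
  built recursively. Both orders of composition are recorded because the spectrum is defined through
  two-sided inverses.\<close>

lemma power_diff_factor:
  assumes A: "bop A"
  shows "\<exists>P. bop P \<and> (\<forall>f\<in>E. (A ^^ n) f - scale_l1loc (z ^ n) f = P (A f - scale_l1loc z f)) \<and>
    (\<forall>f\<in>E. (A ^^ n) f - scale_l1loc (z ^ n) f = A (P f) - scale_l1loc z (P f))"
proof (induction n)
  case 0
  have "A 0 = 0" using bop_scale[OF A, of 0 0] by simp
  thus ?case by (intro exI[of _ "\<lambda>_. 0"]) (simp add: bop_zero)
next
  case (Suc n)
  then obtain P where P: "bop P"
    "\<And>f. f \<in> E \<Longrightarrow> (A ^^ n) f - scale_l1loc (z ^ n) f = P (A f - scale_l1loc z f)"
    "\<And>f. f \<in> E \<Longrightarrow> (A ^^ n) f - scale_l1loc (z ^ n) f = A (P f) - scale_l1loc z (P f)" by blast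
  have An: "(A ^^ n) f \<in> E" if "f \<in> E" for f using bop_closed[OF bop_funpow[OF A]] that .
  have Suc_eq: "(A ^^ Suc n) f - scale_l1loc (z ^ Suc n) f =
      A ((A ^^ n) f - scale_l1loc (z ^ n) f) + scale_l1loc (z ^ n) (A f - scale_l1loc z f)"
    if f: "f \<in> E" for f
    using f by (simp add: bop_diff[OF A] bop_scale[OF A] An l1loc.scale_right_diff_distrib mult.commute)
  show ?case
  proof (intro exI[of _ "\<lambda>f. A (P f) + scale_l1loc (z ^ n) f"] conjI ballI)
    show "bop (\<lambda>f. A (P f) + scale_l1loc (z ^ n) f)"
      by (rule bop_plus[OF bop_comp[OF A P(1)] bop_scaled[OF bop_id]])
    fix f assume f: "f \<in> E"
    show "(A ^^ Suc n) f - scale_l1loc (z ^ Suc n) f = A (P (A f - scale_l1loc z f)) +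
        scale_l1loc (z ^ n) (A f - scale_l1loc z f)"
      using Suc_eq[OF f] P(2)[OF f] by simp
    have "A (A (P f)) \<in> E" "A (P f) \<in> E" "P f \<in> E" using f A P by (auto intro: bop_closed)
    thus "(A ^^ Suc n) f - scale_l1loc (z ^ Suc n) f = A (A (P f) + scale_l1loc (z ^ n) f) -
        scale_l1loc z (A (P f) + scale_l1loc (z ^ n) f)"
      using f by (simp only: Suc_eq P(3))
        (simp add: bop_diff[OF A] bop_add[OF A] bop_scale[OF A] An l1loc.scale_right_diff_distrib
          l1loc.scale_right_distrib mult.commute)
  qed
qed

text \<open>If \<open>B\<close> inverts \<open>A^n - z^n = P (A - z) = (A - z) P\<close>, then
  \<open>B P\<close> is a left inverse and \<open>P B\<close> a right inverse of
  \<open>A - z\<close>, so the two agree.\<close>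

lemma spec_power:
  assumes A: "bop A" and z: "z \<in> spec E N A"
  shows "z ^ n \<in> spec E N (A ^^ n)"
proof (rule ccontr)
  assume "z ^ n \<notin> spec E N (A ^^ n)"
  then obtain B where B: "bop B" "\<And>f. f \<in> E \<Longrightarrow> B ((A ^^ n) f - scale_l1loc (z ^ n) f) = f"
    "\<And>f. f \<in> E \<Longrightarrow> (A ^^ n) (B f) - scale_l1loc (z ^ n) (B f) = f"
    by (rule notin_specD) blast
  obtain P where P: "bop P"
    "\<And>f. f \<in> E \<Longrightarrow> (A ^^ n) f - scale_l1loc (z ^ n) f = P (A f - scale_l1loc z f)"
    "\<And>f. f \<in> E \<Longrightarrow> (A ^^ n) f - scale_l1loc (z ^ n) f = A (P f) - scale_l1loc z (P f)"
    using power_diff_factor[OF A, of n z] by blast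
  have left: "B (P (A f - scale_l1loc z f)) = f" if "f \<in> E" for f
    using B(2) P(2) that by metis
  have right: "A (P (B f)) - scale_l1loc z (P (B f)) = f" if "f \<in> E" for f
    using B(1,3) P(3) bop_closed that by metis
  have "B (P f) = P (B f)" if "f \<in> E" for f
    using left[of "P (B f)"] right[OF that] that B P by (simp add: bop_closed)
  hence "A (B (P f)) - scale_l1loc z (B (P f)) = f" if "f \<in> E" for f
    using right that by simp
  moreover have "bop (\<lambda>f. B (P f))" using B P by (simp add: bop_comp)
  ultimately show False using z left unfolding spec_def by blast
qed

text \<open>Half of the spectral radius formula: the Neumann bound is applied to \<open>A^n\<close>,
  whose spectrum contains \<open>z^n\<close>.\<close>

lemma spec_le_power_bound:
  assumes A: "bop A" and c: "0 \<le> c" "\<And>f. f \<in> E \<Longrightarrow> N ((A ^^ n) f) \<le> c * N f"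
    and z: "z \<in> spec E N A"
  shows "cmod z ^ n \<le> c"
proof (rule ccontr)
  assume "\<not> ?thesis"
  hence "z ^ n \<notin> spec E N (A ^^ n)"
    by (intro spec_bounded[OF bop_funpow[OF A] c]) (auto simp: norm_power)
  thus False using spec_power[OF A z] by blast
qed

lemma cmod_spec_le_spec_radius:
  assumes A: "bop A" and z: "z \<in> spec E N A"
  shows "cmod z \<le> spec_radius E N A"
proof -
  obtain C where C: "0 < C" "\<And>f. f \<in> E \<Longrightarrow> N (A f) \<le> C * N f" by (rule bop_bound[OF A]) blast
  have "bdd_above (cmod ` spec E N A)"
    by (rule bdd_aboveI2[of _ _ C]) (use spec_le_power_bound[OF A, of C 1] C in auto)
  thus ?thesis unfolding spec_radius_def using z by (rule cSUP_upper[rotated])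
qed

section \<open>Operators similar to their rotations\<close>

text \<open>\<open>V a\<close> conjugates \<open>A\<close> to its rotation by \<open>cis a\<close>,
  so the single resolvent at \<open>z\<close> yields the inverses \<open>R a\<close> of all
  \<open>1 - (cis a / z) A\<close>, with a common bound since the \<open>V a\<close> are uniformly
  bounded. The resolvent identity then makes \<open>R\<close> Lipschitz in \<open>a\<close>.\<close>

lemma notin_spec_imp_rotated_inverses:
  fixes V :: "real \<Rightarrow> l1loc \<Rightarrow> l1loc"
  assumes A: "bop A" and V: "\<And>a. bop (V a)" and K: "\<And>a f. f \<in> E \<Longrightarrow> N (V a f) \<le> K * N f"
    and V_inverse: "\<And>a f. f \<in> E \<Longrightarrow> V a (V (- a) f) = f"
    and rot: "\<And>a f. f \<in> E \<Longrightarrow> V a (A f) = scale_l1loc (cis a) (A (V a f))"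
    and z: "z \<noteq> 0" "z \<notin> spec E N A"
  obtains R L where "\<And>a. bop (R a)"
    "\<And>a f. f \<in> E \<Longrightarrow> R a (f - scale_l1loc (cis a / z) (A f)) = f"
    "\<And>a f. f \<in> E \<Longrightarrow> R a f - scale_l1loc (cis a / z) (A (R a f)) = f"
    "\<And>a b f. f \<in> E \<Longrightarrow> N (R a f - R b f) \<le> L * \<bar>a - b\<bar> * N f"
proof -
  obtain B where B: "bop B" "\<And>f. f \<in> E \<Longrightarrow> B (A f - scale_l1loc z f) = f"
    "\<And>f. f \<in> E \<Longrightarrow> A (B f) - scale_l1loc z (B f) = f" using notin_specD[OF z(2)] by metis
  \<comment> \<open>\<open>V a (A - z) V(-a) = cis a A - z = - z (1 - (cis a / z) A)\<close>, whence
    the factor \<open>- z\<close>.\<close>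
  define R where "R a f = scale_l1loc (- z) (V a (B (V (- a) f)))" for a f
  have R: "bop (R a)" for a
    unfolding R_def by (rule bop_scaled[OF bop_comp[OF V bop_comp[OF B(1) V]]])
  note closed = bop_closed[OF A] bop_closed[OF V] bop_closed[OF B(1)] bop_closed[OF R]
  have left: "R a (f - scale_l1loc (cis a / z) (A f)) = f" if f: "f \<in> E" for a f
  proof -
    let ?g = "V (- a) f"
    have "V (- a) (f - scale_l1loc (cis a / z) (A f)) = ?g - scale_l1loc (cis a / z * cis (- a)) (A ?g)"
      using f by (simp add: closed bop_diff[OF V] bop_scale[OF V] rot)
    also have "cis a / z * cis (- a) = 1 / z" by (simp add: cis_mult)
    also have "?g - scale_l1loc (1 / z) (A ?g) = scale_l1loc (- (1 / z)) (A ?g - scale_l1loc z ?g)"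
      using z by (simp add: l1loc.scale_right_diff_distrib)
    finally have "B (V (- a) (f - scale_l1loc (cis a / z) (A f))) = scale_l1loc (- (1 / z)) ?g"
      using f by (simp add: closed bop_scale[OF B(1)] B(2) del: l1loc.scale_minus_left)
    thus ?thesis
      using f z by (simp add: R_def closed bop_scale[OF V] V_inverse del: l1loc.scale_minus_left)
  qed
  have right: "R a f - scale_l1loc (cis a / z) (A (R a f)) = f" if f: "f \<in> E" for a f
  proof -
    let ?g = "B (V (- a) f)"
    have "R a f - scale_l1loc (cis a / z) (A (R a f)) =
        scale_l1loc (cis a) (A (V a ?g)) - scale_l1loc z (V a ?g)"
      using f z by (simp add: R_def closed bop_scale[OF A] del: l1loc.scale_minus_left) simp
    also have "\<dots> = V a (A ?g - scale_l1loc z ?g)"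
      using f by (simp add: closed bop_diff[OF V] bop_scale[OF V] rot)
    also have "\<dots> = f" using f by (simp add: closed B V_inverse)
    finally show ?thesis .
  qed
  obtain D where D: "0 < D" "\<And>f. f \<in> E \<Longrightarrow> N (B f) \<le> D * N f" by (rule bop_bound[OF B(1)]) blast
  obtain G where G: "0 < G" "\<And>f. f \<in> E \<Longrightarrow> N (A f) \<le> G * N f" by (rule bop_bound[OF A]) blast
  define K' where "K' = max K 1"
  have K': "0 < K'" "\<And>a f. f \<in> E \<Longrightarrow> N (V a f) \<le> K' * N f"
  proof -
    show "0 < K'" by (simp add: K'_def)
    show "N (V a f) \<le> K' * N f" if "f \<in> E" for a f
      using K[OF that, of a] mult_right_mono[OF max.cobounded1 N_nonneg[OF that], of K 1]
      by (simp add: K'_def)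
  qed
  define M where "M = cmod z * (K' * (D * K'))"
  have M: "0 \<le> M" using K' D by (simp add: M_def)
  have NR: "N (R a f) \<le> M * N f" if f: "f \<in> E" for a f
  proof -
    have 1: "N (V (- a) f) \<le> K' * N f" by (rule K'(2)[OF f])
    have "N (B (V (- a) f)) \<le> D * N (V (- a) f)" using f by (intro D(2)) (simp add: closed)
    hence 2: "N (B (V (- a) f)) \<le> D * (K' * N f)"
      by (rule order.trans[OF _ mult_left_mono[OF 1]]) (use D(1) in simp)
    have "N (V a (B (V (- a) f))) \<le> K' * N (B (V (- a) f))"
      using f by (intro K'(2)) (simp add: closed)
    hence 3: "N (V a (B (V (- a) f))) \<le> K' * (D * (K' * N f))"
      by (rule order.trans[OF _ mult_left_mono[OF 2]]) (use K'(1) in simp)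
    have "N (R a f) = cmod z * N (V a (B (V (- a) f)))"
      using f by (simp add: R_def closed N_scale del: l1loc.scale_minus_left)
    thus ?thesis using mult_left_mono[OF 3, of "cmod z"] by (simp add: M_def mult.assoc)
  qed
  have lip: "N (R a f - R b f) \<le> M * G * M / cmod z * \<bar>a - b\<bar> * N f" if f: "f \<in> E" for a b f
  proof -
    define h where "h = R b f"
    have h: "h \<in> E" "A h \<in> E" using f by (simp_all add: h_def closed)
    have hf: "h - scale_l1loc (cis b / z) (A h) = f" unfolding h_def by (rule right[OF f])
    \<comment> \<open>The resolvent identity: \<open>R a f - R b f\<close> is \<open>R a\<close>
      applied to \<open>((cis a - cis b) / z) A (R b f)\<close>.\<close>
    have "R a f - h = R a f - R a (h - scale_l1loc (cis a / z) (A h))" by (simp only: left[OF h(1)])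
    also have "\<dots> = R a (f - (h - scale_l1loc (cis a / z) (A h)))"
      using f h by (intro bop_diff[OF R, symmetric]) simp_all
    also have "f - (h - scale_l1loc (cis a / z) (A h)) = scale_l1loc ((cis a - cis b) / z) (A h)"
      by (subst hf[symmetric]) (simp add: l1loc.scale_left_diff_distrib diff_divide_distrib)
    finally have "N (R a f - h) \<le> M * (cmod ((cis a - cis b) / z) * N (A h))"
      using NR[of "scale_l1loc ((cis a - cis b) / z) (A h)" a] h by (simp add: N_scale)
    also have "\<dots> \<le> M * (\<bar>a - b\<bar> / cmod z * (G * (M * N f)))"
    proof (intro mult_left_mono mult_mono)
      show "cmod ((cis a - cis b) / z) \<le> \<bar>a - b\<bar> / cmod z"
      proof -
        \<comment> \<open>A chord of the unit circle is no longer than its arc.\<close>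
        have "cmod (cis a - cis b) \<le> \<bar>a - b\<bar>"
        proof -
          have "cis a - cis b = cis b * (cis (a - b) - 1)" by (simp add: algebra_simps cis_mult)
          hence "cmod (cis a - cis b) = cmod (cis (a - b) - 1)" by (simp add: norm_mult)
          also have "\<dots> = 2 * \<bar>sin ((a - b) / 2)\<bar>"
            using dist_exp_i_1[of "a - b"] by (simp add: cis_conv_exp)
          also have "\<dots> \<le> \<bar>a - b\<bar>" using abs_sin_x_le_abs_x[of "(a - b) / 2"] by simp
          finally show ?thesis .
        qed
        thus ?thesis by (simp add: norm_divide divide_right_mono)
      qed
      have "N (A h) \<le> G * N h" by (rule G(2)[OF h(1)])
      also have "\<dots> \<le> G * (M * N f)" using NR[OF f, of b] G(1) by (simp add: h_def)
      finally show "N (A h) \<le> G * (M * N f)" .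
    qed (use M N_nonneg[OF h(2)] in auto)
    finally show ?thesis by (simp add: h_def mult_ac)
  qed
  show ?thesis
    by (rule that[OF R left right lip])
qed

text \<open>Since \<open>(1 - X\<^sup>2)\<^sup>-\<^sup>1\<close> is the mean of \<open>(1 - X)\<^sup>-\<^sup>1\<close> and \<open>(1 + X)\<^sup>-\<^sup>1\<close>, and the latter
  is obtained from the former by rotating, repeated averaging yields the inverses of
  \<open>1 - X\<close> for \<open>X\<close> the powers of \<open>A / z\<close> with exponent \<open>2 ^ k\<close>.\<close>

primrec avg :: "(real \<Rightarrow> l1loc \<Rightarrow> l1loc) \<Rightarrow> nat \<Rightarrow> real \<Rightarrow> l1loc \<Rightarrow> l1loc" where
  "avg R 0 = R"
| "avg R (Suc k) = (\<lambda>a f. scale_l1loc (1/2) (avg R k a f + avg R k (a + pi / 2 ^ k) f))"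

lemma bop_avg: "(\<And>a. bop (R a)) \<Longrightarrow> bop (avg R k a)"
  by (induction k arbitrary: a) (simp_all only: avg.simps bop_scaled bop_plus)

text \<open>Averaging shifts both angles by the same amount, so the Lipschitz constant does not grow
  with \<open>k\<close>. This is what makes the increments of the averages geometric.\<close>

lemma avg_lipschitz:
  assumes R: "\<And>a. bop (R a)" and f: "f \<in> E"
    and L: "\<And>a b. N (R a f - R b f) \<le> L * \<bar>a - b\<bar> * N f"
  shows "N (avg R k a f - avg R k b f) \<le> L * \<bar>a - b\<bar> * N f"
proof (induction k arbitrary: a b)
  case (Suc k)
  have [simp]: "avg R j c f \<in> E" for j c using bop_closed[OF bop_avg[OF R] f] .
  let ?h = "pi / 2 ^ k"
  have eq: "avg R (Suc k) a f - avg R (Suc k) b f = scale_l1loc (1/2)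
     ((avg R k a f - avg R k b f) + (avg R k (a + ?h) f - avg R k (b + ?h) f))"
    by (simp add: l1loc.scale_right_diff_distrib l1loc.scale_right_distrib)
  show ?case
    unfolding eq using Suc.IH[of a b] Suc.IH[of "a + ?h" "b + ?h"] by (intro N_average) simp_all
qed (use L in simp)

lemma avg_inverse:
  assumes A: "bop A" and R: "\<And>a. bop (R a)"
    and left: "\<And>a f. f \<in> E \<Longrightarrow> R a (f - scale_l1loc (cis a / z) (A f)) = f"
    and right: "\<And>a f. f \<in> E \<Longrightarrow> R a f - scale_l1loc (cis a / z) (A (R a f)) = f"
    and f: "f \<in> E"
  shows "avg R k a (f - scale_l1loc ((cis a / z) ^ 2 ^ k) ((A ^^ 2 ^ k) f)) = f \<and>
    avg R k a f - scale_l1loc ((cis a / z) ^ 2 ^ k) ((A ^^ 2 ^ k) (avg R k a f)) = f"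
  using f
proof (induction k arbitrary: a f)
  case (Suc k)
  let ?Q = "A ^^ 2 ^ k" let ?b = "a + pi / 2 ^ k" let ?c = "(cis a / z) ^ 2 ^ k"
  note Q = bop_funpow[OF A] and T = bop_avg[OF R]
  note [simp] = Suc.prems bop_closed[OF T] bop_closed[OF Q] bop_diff[OF Q] bop_diff[OF T]
    bop_add[OF Q] bop_add[OF T] bop_scale[OF Q] bop_scale[OF T]
  \<comment> \<open>Rotating by \<open>pi / 2^k\<close> multiplies the \<open>2^k\<close>-th power
    by \<open>e^{i pi} = -1\<close>, so the two averaged operators invert \<open>1 - X\<close> and
    \<open>1 + X\<close>, where \<open>X\<close> is \<open>?Q\<close> scaled by
    \<open>?c\<close>.\<close>
  have "cis ?b ^ 2 ^ k = - (cis a ^ 2 ^ k)"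
    by (simp add: power_mult_distrib Complex.DeMoivre[of "pi / 2 ^ k"] flip: cis_mult)
  hence b: "(cis ?b / z) ^ 2 ^ k = - ?c" by (simp add: power_divide)
  have c: "(cis a / z) ^ 2 ^ Suc k = ?c * ?c"
    by (metis mult_2 power_Suc power_add)
  have QQ: "(A ^^ 2 ^ Suc k) g = ?Q (?Q g)" for g
    by (metis comp_apply funpow_add mult_2 power_Suc)
  have 1: "avg R k a (g - scale_l1loc ?c (?Q g)) = g"
    "avg R k a g - scale_l1loc ?c (?Q (avg R k a g)) = g" if "g \<in> E" for g
    using Suc.IH[OF that, of a] by auto
  have 2: "avg R k ?b (g + scale_l1loc ?c (?Q g)) = g"
    "avg R k ?b g + scale_l1loc ?c (?Q (avg R k ?b g)) = g" if "g \<in> E" for g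
    using Suc.IH[OF that, of ?b] unfolding b by auto
  have half: "scale_l1loc (1/2) (g + g) = g" for g :: l1loc
    by (simp add: l1loc.scale_right_distrib flip: l1loc.scale_left_distrib)
  show ?case
  proof
    let ?g = "f - scale_l1loc (?c * ?c) (?Q (?Q f))"
    \<comment> \<open>Here \<open>?g = (1 - X^2) f\<close>. Factoring \<open>1 - X^2\<close> in
      either order, the two inverses send \<open>?g\<close> to \<open>(1 + X) f\<close> and
      \<open>(1 - X) f\<close>, whose mean is \<open>f\<close>.\<close>
    have "?g = (f + scale_l1loc ?c (?Q f)) - scale_l1loc ?c (?Q (f + scale_l1loc ?c (?Q f)))"
      by (simp add: l1loc.scale_right_distrib)
    hence "avg R k a ?g = f + scale_l1loc ?c (?Q f)" by (simp only: 1 E_add E_scale bop_closed[OF Q] Suc.prems)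
    moreover have "?g = (f - scale_l1loc ?c (?Q f)) + scale_l1loc ?c (?Q (f - scale_l1loc ?c (?Q f)))"
      by (simp add: l1loc.scale_right_diff_distrib)
    hence "avg R k ?b ?g = f - scale_l1loc ?c (?Q f)" by (simp only: 2 E_diff E_scale bop_closed[OF Q] Suc.prems)
    ultimately have "avg R (Suc k) a ?g = scale_l1loc (1/2) (f + f)"
      by (simp only: avg.simps) simp
    thus "avg R (Suc k) a (f - scale_l1loc ((cis a / z) ^ 2 ^ Suc k) ((A ^^ 2 ^ Suc k) f)) = f"
      by (simp only: c QQ half)
    let ?u = "avg R k a f" and ?v = "avg R k ?b f"
    let ?Z = "\<lambda>g. g - scale_l1loc (?c * ?c) (?Q (?Q g))"
    have "?Z ?u = (?u - scale_l1loc ?c (?Q ?u)) + scale_l1loc ?c (?Q (?u - scale_l1loc ?c (?Q ?u)))"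
      by (simp add: l1loc.scale_right_diff_distrib)
    hence u: "?Z ?u = f + scale_l1loc ?c (?Q f)" by (simp only: 1 Suc.prems)
    have "?Z ?v = (?v + scale_l1loc ?c (?Q ?v)) - scale_l1loc ?c (?Q (?v + scale_l1loc ?c (?Q ?v)))"
      by (simp add: l1loc.scale_right_distrib)
    hence v: "?Z ?v = f - scale_l1loc ?c (?Q f)" by (simp only: 2 Suc.prems)
    have "?Z (scale_l1loc (1/2) (?u + ?v)) = scale_l1loc (1/2) (?Z ?u + ?Z ?v)"
      by (simp add: l1loc.scale_right_diff_distrib l1loc.scale_right_distrib algebra_simps)
    also have "\<dots> = f" unfolding u v by (simp add: half)
    finally show "avg R (Suc k) a f - scale_l1loc ((cis a / z) ^ 2 ^ Suc k)
        ((A ^^ 2 ^ Suc k) (avg R (Suc k) a f)) = f"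
      by (simp only: c QQ avg.simps)
  qed
qed (use left right in simp)

lemma notin_spec_imp_power_inverses:
  fixes V :: "real \<Rightarrow> l1loc \<Rightarrow> l1loc"
  assumes A: "bop A" and V: "\<And>a. bop (V a)" and K: "\<And>a f. f \<in> E \<Longrightarrow> N (V a f) \<le> K * N f"
    and V_inverse: "\<And>a f. f \<in> E \<Longrightarrow> V a (V (- a) f) = f"
    and rot: "\<And>a f. f \<in> E \<Longrightarrow> V a (A f) = scale_l1loc (cis a) (A (V a f))"
    and z: "z \<noteq> 0" "z \<notin> spec E N A"
  obtains T c where "\<And>k. bop (T k)"
    "\<And>k f. f \<in> E \<Longrightarrow> T k (f - scale_l1loc ((1 / z) ^ 2 ^ k) ((A ^^ 2 ^ k) f)) = f"
    "\<And>k f. f \<in> E \<Longrightarrow> T k f - scale_l1loc ((1 / z) ^ 2 ^ k) ((A ^^ 2 ^ k) (T k f)) = f"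
    "\<And>k f. f \<in> E \<Longrightarrow> N (T k f - T (Suc k) f) \<le> c * N f * (1/2) ^ k"
proof -
  show ?thesis
  proof (rule notin_spec_imp_rotated_inverses[OF assms])
    fix R L assume R: "\<And>a. bop (R a)"
      "\<And>a f. f \<in> E \<Longrightarrow> R a (f - scale_l1loc (cis a / z) (A f)) = f"
      "\<And>a f. f \<in> E \<Longrightarrow> R a f - scale_l1loc (cis a / z) (A (R a f)) = f"
      "\<And>a b f. f \<in> E \<Longrightarrow> N (R a f - R b f) \<le> L * \<bar>a - b\<bar> * N f"
    note T = bop_avg[of R, OF R(1)]
    note inv = avg_inverse[OF A R(1-3), of _ _ 0, unfolded cis_zero]
    show thesis
    \<comment> \<open>Consecutive averages at angle 0 differ by half of the change of
      \<open>avg R k\<close> over an angle \<open>pi / 2^k\<close>; the Lipschitz bound then gives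
      \<open>c = L * pi\<close>.\<close>
    proof (rule that[of "\<lambda>k. avg R k 0" "L * pi"])
      fix k f assume f: "f \<in> E"
      let ?h = "pi / 2 ^ k"
      have [simp]: "avg R k a f \<in> E" for a using bop_closed[OF T f] .
      have "avg R k 0 f = scale_l1loc (1/2 + 1/2) (avg R k 0 f)" by simp
      also have "\<dots> = scale_l1loc (1/2) (avg R k 0 f) + scale_l1loc (1/2) (avg R k 0 f)"
        by (rule l1loc.scale_left_distrib)
      finally have "avg R k 0 f - avg R (Suc k) 0 f = scale_l1loc (1/2) (avg R k 0 f) +
          scale_l1loc (1/2) (avg R k 0 f) - avg R (Suc k) 0 f" by (rule arg_cong)
      also have "\<dots> = scale_l1loc (1/2) (avg R k 0 f - avg R k ?h f)"
        by (simp add: l1loc.scale_right_diff_distrib l1loc.scale_right_distrib)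
      finally have "N (avg R k 0 f - avg R (Suc k) 0 f) = 1/2 * N (avg R k 0 f - avg R k ?h f)"
        by (simp add: N_scale norm_divide del: avg.simps)
      also have "\<dots> \<le> N (avg R k 0 f - avg R k ?h f)" using N_nonneg[of "avg R k 0 f - avg R k ?h f"] by simp
      also have "\<dots> \<le> L * \<bar>0 - ?h\<bar> * N f" by (rule avg_lipschitz[OF R(1) f R(4)[OF f]])
      finally show "N (avg R k 0 f - avg R (Suc k) 0 f) \<le> L * pi * N f * (1/2) ^ k"
        by (simp add: power_divide)
    qed (use T inv in auto)
  qed
qed

text \<open>The increments are bounded by a multiple of \<open>N f\<close> uniformly in
  \<open>f\<close>, so pointwise convergence of \<open>T k f\<close> to \<open>f\<close> on a dense
  set already gives \<open>N (T k f - f) \<le> N f / 3\<close> on all of \<open>E\<close> for one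
  \<open>k\<close>. As \<open>T k\<close> inverts \<open>1 - X\<close> with
  \<open>X = (A / z)^(2^k)\<close>, this forces \<open>X\<close> to have norm at most
  \<open>1/2\<close>.\<close>

lemma inverses_tendsto_id_imp_power_small:
  assumes A: "bop A" and T: "\<And>k. bop (T k)"
    and left: "\<And>k f. f \<in> E \<Longrightarrow> T k (f - scale_l1loc ((1 / z) ^ 2 ^ k) ((A ^^ 2 ^ k) f)) = f"
    and inc: "\<And>k f. f \<in> E \<Longrightarrow> N (T k f - T (Suc k) f) \<le> c * N f * (1/2) ^ k"
    and D: "D \<subseteq> E" "\<And>f e. f \<in> E \<Longrightarrow> 0 < e \<Longrightarrow> \<exists>g\<in>D. N (f - g) < e"
    and lim: "\<And>f. f \<in> D \<Longrightarrow> (\<lambda>k. N (T k f - f)) \<longlonglongrightarrow> 0"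
    and z: "z \<noteq> 0"
  shows "\<exists>n>0. \<forall>f\<in>E. N ((A ^^ n) f) \<le> cmod z ^ n / 2 * N f"
proof -
  have "(\<lambda>k. 2 * c * (1/2) ^ k) \<longlonglongrightarrow> 2 * c * 0"
    by (intro tendsto_intros LIMSEQ_power_zero) simp
  \<comment> \<open>The increments from \<open>k\<close> on add up to at most
    \<open>2 c (1/2)^k N f\<close>. The bound \<open>1/3\<close> is chosen because
    \<open>N h \<le> (N f + N h) / 3\<close> gives \<open>N h \<le> N f / 2\<close> below.\<close>
  then obtain k where k: "2 * c * (1/2) ^ k < 1 / 3"
    using order_tendstoD(2)[of "\<lambda>k. 2 * c * (1/2) ^ k" 0 sequentially "1/3::real"]
    unfolding eventually_sequentially by (metis order_refl mult_zero_right zero_less_divide_1_iff zero_less_numeral)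
  have TE [simp]: "T j f \<in> E" if "f \<in> E" for j f using bop_closed[OF T that] .
  have on_D: "N (T k f - f) \<le> 1 / 3 * N f" if "f \<in> D" for f
  proof -
    have f: "f \<in> E" using that D by auto
    have "N (T k f - T l f) \<le> 1 / 3 * N f" if "k \<le> l" for l
    proof -
      have "N (T k f - T l f) \<le> c * N f * (1/2) ^ k / (1 - 1/2)"
        by (rule geometric_increments[OF _ inc[OF f]]) (use f that in auto)
      also have "\<dots> = 2 * c * (1/2) ^ k * N f" by simp
      also have "\<dots> \<le> 1 / 3 * N f" using k N_nonneg[OF f] by (intro mult_right_mono) auto
      finally show ?thesis .
    qed
    hence "N (T k f - f) \<le> 1 / 3 * N f + N (T l f - f)" if "k \<le> l" for l
      using N_triangle3[of "T k f" "T l f" f] f that by fastforce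
    moreover have "(\<lambda>l. 1 / 3 * N f + N (T l f - f)) \<longlonglongrightarrow> 1 / 3 * N f + 0"
      by (intro tendsto_intros lim that)
    ultimately show ?thesis
      using LIMSEQ_le_const[of "\<lambda>l. 1 / 3 * N f + N (T l f - f)" "1 / 3 * N f" "N (T k f - f)"] by auto
  qed
  obtain B where B: "0 < B" "\<And>f. f \<in> E \<Longrightarrow> N (T k f) \<le> B * N f" by (rule bop_bound[OF T]) blast
  have on_E: "N (T k f - f) \<le> 1 / 3 * N f" if f: "f \<in> E" for f
  proof (rule field_le_epsilon)
    fix e :: real assume "0 < e"
    \<comment> \<open>The coefficient of \<open>N (f - g)\<close> is \<open>B + 1\<close>, from
      \<open>T k\<close> and the identity, plus \<open>1/3\<close> from
      \<open>N g \<le> N (f - g) + N f\<close>.\<close>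
    define d where "d = e / (B + 4 / 3)"
    have "0 < d" using \<open>0 < e\<close> B by (simp add: d_def)
    then obtain g where g: "g \<in> D" "N (f - g) < d" using D(2)[OF f] by blast
    have gE: "g \<in> E" using g D by auto
    have split: "T k f - f = (T k (f - g) - (f - g)) + (T k g - g)"
      using f gE by (simp add: bop_diff[OF T])
    have "N (T k f - f) \<le> N (T k (f - g) - (f - g)) + N (T k g - g)"
      unfolding split using f gE by (intro N_triangle) simp_all
    also have "N (T k (f - g) - (f - g)) \<le> B * N (f - g) + N (f - g)"
      using N_triangle_diff[of "T k (f - g)" "f - g"] B(2)[of "f - g"] f gE by simp
    also have "N (T k g - g) \<le> 1 / 3 * N g" by (rule on_D[OF g(1)])
    also have "N g \<le> N (f - g) + N f"
      using N_triangle_diff'[of g f] N_diff_commute[of f g] f gE by simp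
    finally have "N (T k f - f) \<le> (B + 4 / 3) * N (f - g) + 1 / 3 * N f"
      by (simp add: algebra_simps)
    also have "(B + 4 / 3) * N (f - g) \<le> (B + 4 / 3) * d"
      using g(2) B(1) by (intro mult_left_mono) auto
    also have "\<dots> = e" using B(1) by (simp add: d_def)
    finally show "N (T k f - f) \<le> 1 / 3 * N f + e" by simp
  qed
  show ?thesis
  proof (intro exI[of _ "2 ^ k"] conjI ballI)
    fix f assume f: "f \<in> E"
    define h where "h = scale_l1loc ((1 / z) ^ 2 ^ k) ((A ^^ 2 ^ k) f)"
    have h: "h \<in> E" using f by (simp add: h_def bop_closed[OF bop_funpow[OF A]])
    \<comment> \<open>At the argument \<open>f - h\<close> the operator \<open>T k\<close> has the
      value \<open>f\<close>, so its distance from the identity there is exactly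
      \<open>N h\<close>.\<close>
    have "N (f - (f - h)) \<le> 1 / 3 * N (f - h)"
      using on_E[of "f - h"] left[OF f, of k] f h by (simp flip: h_def)
    hence "N h \<le> N f / 2" using N_triangle_diff[OF f h] by simp
    moreover have "scale_l1loc (z ^ 2 ^ k) h = (A ^^ 2 ^ k) f"
      using z by (simp add: h_def power_one_over)
    hence "N ((A ^^ 2 ^ k) f) = cmod z ^ 2 ^ k * N h" using N_scale[OF h] by (metis norm_power)
    ultimately show "N ((A ^^ 2 ^ k) f) \<le> cmod z ^ 2 ^ k / 2 * N f"
      using mult_left_mono[of "N h" "N f / 2" "cmod z ^ 2 ^ k"] by simp
  qed simp
qed

section \<open>From small powers to disc-shaped spectra\<close>

lemma spec_radius_less:
  assumes A: "bop A" and n: "0 < n" "\<forall>f\<in>E. N ((A ^^ n) f) \<le> cmod z ^ n / 2 * N f"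
    and z: "z \<noteq> 0" and ne: "spec E N A \<noteq> {}"
  shows "spec_radius E N A < cmod z"
proof -
  \<comment> \<open>\<open>r\<close> is the \<open>n\<close>-th root of \<open>|z|^n / 2\<close>;
    the factor \<open>root n (1/2) < 1\<close> supplies the strict inequality.\<close>
  define r where "r = root n (1/2) * cmod z"
  have r: "r ^ n = cmod z ^ n / 2" "0 \<le> r" using n(1) by (simp_all add: r_def power_mult_distrib)
  have "cmod w \<le> r" if "w \<in> spec E N A" for w
  proof -
    have "cmod w ^ n \<le> r ^ n"
      unfolding r(1) by (rule spec_le_power_bound[OF A _ _ that]) (use n in auto)
    thus ?thesis using r(2) n(1) by (simp add: power_mono_iff)
  qed
  hence "spec_radius E N A \<le> r"
    unfolding spec_radius_def using ne by (intro cSUP_least) auto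
  also have "r < 1 * cmod z"
    unfolding r_def using z n(1) by (intro mult_strict_right_mono) (simp_all add: real_root_lt_1_iff)
  finally show ?thesis by simp
qed

text \<open>Since \<open>A^n B^n = 1\<close>, a small power of one factor conflicts with the
  exponential bound on the other: at the radii \<open>1 / D\<close> and \<open>1 / C\<close> the
  factor \<open>1/2\<close> would give \<open>N f \<le> N f / 2\<close> for a nonzero
  \<open>f\<close>.\<close>

lemma left_inverse_power_not_small:
  assumes A: "bop A" and B: "bop B" and left: "\<And>f. f \<in> E \<Longrightarrow> A (B f) = f"
    and f: "f \<in> E" "f \<noteq> 0"
  shows "\<exists>r>0. \<forall>n>0. \<not> (\<forall>f\<in>E. N ((A ^^ n) f) \<le> r ^ n / 2 * N f)"
    "\<exists>r>0. \<forall>n>0. \<not> (\<forall>f\<in>E. N ((B ^^ n) f) \<le> r ^ n / 2 * N f)"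
proof -
  have AB: "(A ^^ n) ((B ^^ n) g) = g" if "g \<in> E" for n g
  proof (induction n)
    case (Suc n)
    thus ?case using left[OF bop_closed[OF bop_funpow[OF B] that]] by (simp add: funpow_swap1)
  qed simp
  have Nf: "0 < N f" using f N_nonneg[of f] N_eq_0_iff[of f] by simp
  have Bf: "(B ^^ n) f \<in> E" for n using bop_closed[OF bop_funpow[OF B] f(1)] .
  obtain C where C: "0 < C" "\<And>f. f \<in> E \<Longrightarrow> N (A f) \<le> C * N f" by (rule bop_bound[OF A]) blast
  obtain D where D: "0 < D" "\<And>f. f \<in> E \<Longrightarrow> N (B f) \<le> D * N f" by (rule bop_bound[OF B]) blast
  show "\<exists>r>0. \<forall>n>0. \<not> (\<forall>f\<in>E. N ((A ^^ n) f) \<le> r ^ n / 2 * N f)"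
  proof (intro exI[of _ "1 / D"] conjI allI impI notI)
    fix n :: nat assume *: "\<forall>f\<in>E. N ((A ^^ n) f) \<le> (1 / D) ^ n / 2 * N f"
    have "N f \<le> (1 / D) ^ n / 2 * N ((B ^^ n) f)" using bspec[OF * Bf, of n] AB[OF f(1), of n] by simp
    also have "\<dots> \<le> (1 / D) ^ n / 2 * (D ^ n * N f)"
      using funpow_bound[OF B _ D(2) f(1), of n] D(1) by (intro mult_left_mono) auto
    finally show False using Nf D(1) by (simp add: power_divide)
  qed (use D in simp)
  show "\<exists>r>0. \<forall>n>0. \<not> (\<forall>f\<in>E. N ((B ^^ n) f) \<le> r ^ n / 2 * N f)"
  proof (intro exI[of _ "1 / C"] conjI allI impI notI)
    fix n :: nat assume *: "\<forall>f\<in>E. N ((B ^^ n) f) \<le> (1 / C) ^ n / 2 * N f"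
    have "N f \<le> C ^ n * N ((B ^^ n) f)"
      using funpow_bound[OF A _ C(2) Bf, of n n] AB[OF f(1), of n] C(1) by simp
    also have "\<dots> \<le> C ^ n * ((1 / C) ^ n / 2 * N f)"
      using bspec[OF * f(1)] C(1) by (intro mult_left_mono) auto
    finally show False using Nf C(1) by (simp add: power_divide)
  qed (use C in simp)
qed

text \<open>A nonzero \<open>z\<close> outside the spectrum has modulus above the spectral radius by
  \<open>small\<close>, so every nonzero \<open>z\<close> of modulus at most the radius lies inside.
  The point \<open>r\<close> from \<open>large\<close> must be spectral; it makes the spectrum
  nonempty and its radius positive.\<close>

lemma spec_disc_if_power_dichotomy:
  assumes A: "bop A"
    and small: "\<And>z. z \<noteq> 0 \<Longrightarrow> z \<notin> spec E N A \<Longrightarrow>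
      \<exists>n>0. \<forall>f\<in>E. N ((A ^^ n) f) \<le> cmod z ^ n / 2 * N f"
    and large: "\<exists>r>0. \<forall>n>0. \<not> (\<forall>f\<in>E. N ((A ^^ n) f) \<le> r ^ n / 2 * N f)"
  shows "0 < spec_radius E N A" "z \<noteq> 0 \<Longrightarrow> z \<in> spec E N A \<longleftrightarrow> cmod z \<le> spec_radius E N A"
proof -
  obtain r where r: "0 < r" "\<forall>n>0. \<not> (\<forall>f\<in>E. N ((A ^^ n) f) \<le> r ^ n / 2 * N f)" using large by blast
  have r_spec: "of_real r \<in> spec E N A"
  proof (rule ccontr)
    assume "of_real r \<notin> spec E N A"
    from small[OF _ this] r(1) obtain n where "0 < n" "\<forall>f\<in>E. N ((A ^^ n) f) \<le> r ^ n / 2 * N f" by auto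
    thus False using r(2) by blast
  qed
  show "0 < spec_radius E N A"
    using cmod_spec_le_spec_radius[OF A r_spec] r(1) by simp
  show "z \<in> spec E N A \<longleftrightarrow> cmod z \<le> spec_radius E N A" if "z \<noteq> 0"
  proof
    assume le: "cmod z \<le> spec_radius E N A"
    show "z \<in> spec E N A"
    proof (rule ccontr)
      assume "z \<notin> spec E N A"
      from small[OF that this] obtain n where "0 < n" "\<forall>f\<in>E. N ((A ^^ n) f) \<le> cmod z ^ n / 2 * N f" by blast
      from spec_radius_less[OF A this that] r_spec le show False by auto
    qed
  qed (rule cmod_spec_le_spec_radius[OF A])
qed

end

section \<open>The spectra of the translations\<close>

text \<open>\<open>op_norm\<close> is a real supremum, and boundedness of \<open>A\<close> makes it
  an upper bound; the rest is rescaling \<open>f\<close> to norm 1.\<close>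

lemma (in l1loc_banach) N_le_op_norm:
  assumes A: "bop A" and f: "f \<in> E"
  shows "N (A f) \<le> op_norm E N A * N f"
proof (cases "f = 0")
  case True
  thus ?thesis using bop_scale[OF A f, of 0] by simp
next
  case False
  hence Nf: "0 < N f" using N_nonneg[OF f] N_eq_0_iff[OF f] by simp
  obtain C where C: "0 < C" "\<And>f. f \<in> E \<Longrightarrow> N (A f) \<le> C * N f" by (rule bop_bound[OF A]) blast
  have "bdd_above {N (A f) | f. f \<in> E \<and> N f \<le> 1}"
  proof (rule bdd_aboveI)
    fix y assume "y \<in> {N (A f) | f. f \<in> E \<and> N f \<le> 1}"
    then obtain g where g: "y = N (A g)" "g \<in> E" "N g \<le> 1" by blast
    have "y \<le> C * N g" using g C by simp
    also have "\<dots> \<le> C * 1" using g(3) C(1) by (intro mult_left_mono) auto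
    finally show "y \<le> C" by simp
  qed
  moreover have "N (scale_l1loc (1 / of_real (N f)) f) \<le> 1"
    using f Nf by (simp add: N_scale norm_divide)
  ultimately have "N (A (scale_l1loc (1 / of_real (N f)) f)) \<le> op_norm E N A"
    unfolding op_norm_def using f by (intro cSup_upper) auto
  thus ?thesis using f Nf A by (simp add: bop_scale bop_closed N_scale norm_divide field_simps)
qed

locale translation_space = l1loc_banach +
  assumes H1: "H1 E N" and H2: "H2 E N" and H3: "H3 E N"
begin

lemma bop_translate: "bop (translate a)"
  using H2 by (simp add: H2_def)

lemma bop_modulate: "bop (modulate a)"
  using H3 by (simp add: H3_def)

lemma modulate_bound:
  obtains K where "\<And>a f. f \<in> E \<Longrightarrow> N (modulate a f) \<le> K * N f"
proof -
  obtain K where K: "\<And>a. op_norm E N (modulate a) \<le> K"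
    using H3 unfolding H3_def bdd_above_def by blast
  show ?thesis
  proof (rule that)
    fix a f assume f: "f \<in> E"
    have "N (modulate a f) \<le> op_norm E N (modulate a) * N f" by (rule N_le_op_norm[OF bop_modulate f])
    also have "\<dots> \<le> K * N f" using K N_nonneg[OF f] by (rule mult_right_mono)
    finally show "N (modulate a f) \<le> K * N f" .
  qed
qed

text \<open>By \<open>H1\<close> the preimage of a seminorm ball is open in \<open>E\<close>, so it
  contains a norm ball around \<open>l\<close>.\<close>

lemma l1_seminorm_tendsto:
  assumes x: "\<And>n. x n \<in> E" and l: "l \<in> E" and lim: "(\<lambda>n. N (x n - l)) \<longlonglongrightarrow> 0"
  shows "(\<lambda>n. l1_seminorm r (x n - l)) \<longlonglongrightarrow> 0"
proof (rule order_tendstoI)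
  show "\<forall>\<^sub>F n in sequentially. a < l1_seminorm r (x n - l)" if "a < 0" for a
    using l1_seminorm_nonneg that by (intro always_eventually allI) (rule less_le_trans)
  fix e :: real assume e: "0 < e"
  have "continuous_map mtopology l1loc_topology (\<lambda>f. f)" using H1 by (simp add: H1_def)
  from openin_continuous_map_preimage[OF this openin_l1loc_ball[of r l e]]
  have "openin mtopology {g \<in> E. l1_seminorm r (g - l) < e}" by simp
  moreover have "l \<in> {g \<in> E. l1_seminorm r (g - l) < e}" using l e by simp
  ultimately obtain d where d: "0 < d" "mball l d \<subseteq> {g \<in> E. l1_seminorm r (g - l) < e}"
    unfolding openin_mtopology by blast
  have "\<forall>\<^sub>F n in sequentially. N (x n - l) < d" by (rule order_tendstoD(2)[OF lim d(1)])
  thus "\<forall>\<^sub>F n in sequentially. l1_seminorm r (x n - l) < e"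
  proof (rule eventually_mono)
    fix n assume "N (x n - l) < d"
    hence "x n \<in> mball l d" using x l N_diff_commute[of l "x n"] by (simp add: norm_dist_def)
    thus "l1_seminorm r (x n - l) < e" using d(2) by blast
  qed
qed

lemma test_functions_dense:
  assumes f: "f \<in> E" and e: "0 < e"
  shows "\<exists>g\<in>class_of ` test_functions. N (f - g) < e"
proof -
  have "f \<in> mtopology closure_of (class_of ` test_functions)" using H1 f by (simp add: H1_def)
  then obtain g where "g \<in> class_of ` test_functions" "g \<in> mball f e"
    using e unfolding metric_closure_of by blast
  thus ?thesis by (auto simp: norm_dist_def)
qed

text \<open>For every \<open>f\<close> in \<open>E\<close> the sequence \<open>T k f\<close>
  converges by completeness, and its limit is \<open>f\<close> because \<open>T k f\<close> and
  \<open>f\<close> agree on \<open>[0, 2^k]\<close>. Hence \<open>D = E\<close> can be taken as the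
  dense set.\<close>

lemma right_shift_power_small:
  assumes z: "z \<noteq> 0" "z \<notin> spec E N (translate 1)"
  shows "\<exists>n>0. \<forall>f\<in>E. N ((translate 1 ^^ n) f) \<le> cmod z ^ n / 2 * N f"
proof -
  obtain K where K: "\<And>a f. f \<in> E \<Longrightarrow> N (modulate a f) \<le> K * N f" by (rule modulate_bound) blast
  have mm: "modulate a (modulate (- a) f) = f" for a f by (simp add: modulate_modulate)
  have rot: "modulate a (translate 1 f) = scale_l1loc (cis a) (translate 1 (modulate a f))" for a f
    by (simp add: modulate_translate)
  show ?thesis
  proof (rule notin_spec_imp_power_inverses[OF bop_translate bop_modulate K mm rot z])
    fix T c
    assume T: "\<And>k. bop (T k)"
      and left: "\<And>k f. f \<in> E \<Longrightarrow> T k (f - scale_l1loc ((1 / z) ^ 2 ^ k) ((translate 1 ^^ 2 ^ k) f)) = f"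
      and right: "\<And>k f. f \<in> E \<Longrightarrow>
        T k f - scale_l1loc ((1 / z) ^ 2 ^ k) ((translate 1 ^^ 2 ^ k) (T k f)) = f"
      and inc: "\<And>k f. f \<in> E \<Longrightarrow> N (T k f - T (Suc k) f) \<le> c * N f * (1/2) ^ k"
    show ?thesis
    proof (rule inverses_tendsto_id_imp_power_small[OF bop_translate T left inc, where D = E])
      fix f assume f: "f \<in> E"
      have TE: "T k f \<in> E" for k using bop_closed[OF T f] .
      obtain l where l: "l \<in> E" "(\<lambda>k. N (T k f - l)) \<longlonglongrightarrow> 0"
        by (rule geometric_increments_convergent[OF TE inc[OF f]]) auto
      have Tf: "l1_seminorm r (T k f - f) = 0" if r: "r \<le> 2 ^ k" for r k
      proof -
        \<comment> \<open>The right inverse identity exhibits \<open>T k f - f\<close> as a class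
          shifted right by \<open>2^k\<close>.\<close>
        let ?g = "(translate 1 ^^ 2 ^ k) (scale_l1loc ((1 / z) ^ 2 ^ k) (T k f))"
        have "T k f - f = ?g"
          using right[OF f, of k] TE
          by (simp add: bop_scale[OF bop_funpow[OF bop_translate]] algebra_simps)
        hence "l1_seminorm (2 ^ k) (T k f - f) = 0"
          using translate_funpow_seminorm[of "2 ^ k"] by simp
        thus ?thesis
          using l1_seminorm_mono[OF r, of "T k f - f"] l1_seminorm_nonneg[of r "T k f - f"] by simp
      qed
      have "l1_seminorm r (f - l) = 0" for r
      proof -
        obtain k0 where k0: "r \<le> 2 ^ k0" using real_arch_pow[of 2 r] by (auto intro: less_imp_le)
        have "l1_seminorm r (f - l) \<le> l1_seminorm r (T k f - l)" if "k0 \<le> k" for k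
        proof -
          have "r \<le> 2 ^ k" using order.trans[OF k0 power_increasing[OF that]] by simp
          thus ?thesis
            using l1_seminorm_triangle_diff[of r f l "T k f"] Tf[of r k] l1_seminorm_minus[of r "T k f - f"]
            by simp
        qed
        hence "l1_seminorm r (f - l) \<le> 0"
          by (intro LIMSEQ_le_const[OF l1_seminorm_tendsto[OF TE l]]) auto
        thus ?thesis using l1_seminorm_nonneg[of r "f - l"] by simp
      qed
      hence "f = l" using l1_seminorm_eq_0_iff[of "f - l"] by simp
      thus "(\<lambda>k. N (T k f - f)) \<longlonglongrightarrow> 0" using l(2) by simp
    next
      show "\<exists>g\<in>E. N (f - g) < e" if "f \<in> E" "0 < e" for f and e :: real
        using that by (intro bexI[of _ f]) simp_all
    qed (use z in auto)
  qed
qed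

text \<open>Here the test functions form the dense set: the \<open>2^k\<close>-th power of the left
  shift kills such an \<open>f\<close> once its support lies below \<open>2^k\<close>, and then the
  left inverse identity reads \<open>T k f = f\<close>.\<close>

lemma left_shift_power_small:
  assumes z: "z \<noteq> 0" "z \<notin> spec E N (translate (- 1))"
  shows "\<exists>n>0. \<forall>f\<in>E. N ((translate (- 1) ^^ n) f) \<le> cmod z ^ n / 2 * N f"
proof -
  obtain K where K: "\<And>a f. f \<in> E \<Longrightarrow> N (modulate a f) \<le> K * N f" by (rule modulate_bound) blast
  \<comment> \<open>\<open>modulate a\<close> rotates the left shift by \<open>cis (- a)\<close>, so
    \<open>V a = modulate (- a)\<close> is the family that rotates it by
    \<open>cis a\<close>.\<close>
  have mm: "modulate (- a) (modulate (- (- a)) f) = f" for a f by (simp add: modulate_modulate)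
  have rot: "modulate (- a) (translate (- 1) f) =
      scale_l1loc (cis a) (translate (- 1) (modulate (- a) f))" for a f
    by (simp add: modulate_translate)
  show ?thesis
  proof (rule notin_spec_imp_power_inverses[where V = "\<lambda>a. modulate (- a)",
        OF bop_translate bop_modulate K mm rot z])
    fix T c
    assume T: "\<And>k. bop (T k)"
      and left: "\<And>k f. f \<in> E \<Longrightarrow>
        T k (f - scale_l1loc ((1 / z) ^ 2 ^ k) ((translate (- 1) ^^ 2 ^ k) f)) = f"
      and inc: "\<And>k f. f \<in> E \<Longrightarrow> N (T k f - T (Suc k) f) \<le> c * N f * (1/2) ^ k"
    have sub: "class_of ` test_functions \<subseteq> E" using H1 by (simp add: H1_def)
    show ?thesis
    proof (rule inverses_tendsto_id_imp_power_small[OF bop_translate T left inc sub test_functions_dense])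
      fix f assume "f \<in> class_of ` test_functions"
      then obtain \<phi> where \<phi>: "\<phi> \<in> test_functions" "f = class_of \<phi>" by blast
      obtain b where b: "vanishes_beyond b f"
        using test_function_vanishes_beyond[OF \<phi>(1)] \<phi>(2) by blast
      obtain k0 where k0: "b \<le> 2 ^ k0" using real_arch_pow[of 2 b] by (auto intro: less_imp_le)
      have "N (T k f - f) = 0" if "k0 \<le> k" for k
      proof -
        have "b \<le> real (2 ^ k)" using order.trans[OF k0 power_increasing[OF that]] by simp
        from vanishes_beyond_funpow_translate[OF b this] left[of f k] sub \<phi>
        have "T k f = f" by auto
        thus ?thesis by simp
      qed
      hence "\<forall>\<^sub>F k in sequentially. N (T k f - f) = 0" unfolding eventually_sequentially by blast
      thus "(\<lambda>k. N (T k f - f)) \<longlonglongrightarrow> 0" by (rule tendsto_eventually)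
    qed (use z in auto)
  qed
qed

end

theorem theorem2:
  fixes E :: "l1loc set" and N :: "l1loc \<Rightarrow> real"
  assumes "banach_space E N" and "H1 E N" and "H2 E N" and "H3 E N"
  shows "spec E N (translate 1) \<inter> {1 / z | z. z \<in> spec E N (translate (- 1)) \<and> z \<noteq> 0}
       = {z. 1 / spec_radius E N (translate (- 1)) \<le> cmod z \<and> cmod z \<le> spec_radius E N (translate 1)}"
proof -
  interpret translation_space E N
    using assms by unfold_locales
  \<comment> \<open>A nonzero vector of \<open>E\<close>, from which the lower bounds on the powers
    start.\<close>
  have "class_of (bump 1 1) \<in> E" using H1 bump_test_function by (auto simp: H1_def)
  note large = left_inverse_power_not_small[OF bop_translate bop_translate translate_left_inverse
      this class_of_bump_nonzero]
  let ?\<rho> = "spec_radius E N (translate 1)" and ?\<sigma> = "spec_radius E N (translate (- 1))"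
  have right: "z \<in> spec E N (translate 1) \<longleftrightarrow> cmod z \<le> ?\<rho>" if "z \<noteq> 0" for z
    by (rule spec_disc_if_power_dichotomy(2)[OF bop_translate _ large(2) that])
      (rule right_shift_power_small)
  have left: "z \<in> spec E N (translate (- 1)) \<longleftrightarrow> cmod z \<le> ?\<sigma>" if "z \<noteq> 0" for z
    by (rule spec_disc_if_power_dichotomy(2)[OF bop_translate _ large(1) that])
      (rule left_shift_power_small)
  \<comment> \<open>Positivity keeps the convention \<open>1 / 0 = 0\<close> out of the right-hand
    side.\<close>
  have \<sigma>: "0 < ?\<sigma>"
    by (rule spec_disc_if_power_dichotomy(1)[OF bop_translate _ large(1)]) (rule left_shift_power_small)
  have "z \<in> spec E N (translate 1) \<and> (\<exists>w. z = 1 / w \<and> w \<in> spec E N (translate (- 1)) \<and> w \<noteq> 0) \<longleftrightarrow>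
      1 / ?\<sigma> \<le> cmod z \<and> cmod z \<le> ?\<rho>" for z
  proof (cases "z = 0")
    case False
    have "(\<exists>w. z = 1 / w \<and> w \<in> spec E N (translate (- 1)) \<and> w \<noteq> 0) \<longleftrightarrow>
        1 / z \<in> spec E N (translate (- 1))"
      using False by force
    also have "\<dots> \<longleftrightarrow> 1 / ?\<sigma> \<le> cmod z"
      using \<sigma> left[of "1 / z"] False by (simp add: norm_divide field_simps)
    finally show ?thesis using right[OF False] by blast
  \<comment> \<open>For \<open>z = 0\<close> both sides fail: \<open>1 / w\<close> is nonzero for
    nonzero \<open>w\<close>, and \<open>1 / ?\<sigma>\<close> is positive.\<close>
  qed (use \<sigma> in auto)
  thus ?thesis by blast
qed

end
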